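(* Let $d\ge 1$, let $\|\cdot\|$ be a norm on $\mathbb{R}^d$, and let $r>0$. Let $\mathbf{X}$ be a $d$-dimensional real-valued random vector whose distribution has a probability density function $f_{\mathbf{X}}$ (with respect to Lebesgue measure) such that $\mathbf{x}\mapsto f_{\mathbf{X}}(\mathbf{x})\log f_{\mathbf{X}}(\mathbf{x})$ is integrable, so that the differential entropy $h(\mathbf{X})=-\int f_{\mathbf{X}}(\mathbf{x})\log f_{\mathbf{X}}(\mathbf{x})\,d\mathbf{x}$ is finite. For $D>0$ let $$R(D)=\inf_{P_{\hat{\mathbf{X}}|\mathbf{X}}\colon \mathbb{E}[\|\mathbf{X}-\hat{\mathbf{X}}\|^r]\le D} I(\mathbf{X};\hat{\mathbf{X}}),$$ the infimum being over all conditional distributions of a $d$-dimensional random vector $\hat{\mathbf{X}}$ given $\mathbf{X}$ satisfying $\mathbb{E}[\|\mathbf{X}-\hat{\mathbf{X}}\|^r]\le D$ (expectation under $P_{\mathbf{X}}P_{\hat{\mathbf{X}}|\mathbf{X}}$), and let $$R_{\mathrm{SLB}}(D)=h(\mathbf{X})+\frac{d}{r}\log\frac{1}{D}-\frac{d}{r}\log\left(\frac{r}{d}\bigl(V_d\,\Gamma(1+d/r)\bigr)^{r/d}e\right),$$ where $V_d$ is the Lebesgue volume of the unit ball $\{\mathbf{x}\in\mathbb{R}^d:\|\mathbf{x}\|\le 1\}$. Then: (a) if $H(\lfloor\mathbf{X}\rfloor)<\infty$, then $\lim_{D\downarrow 0}\{R(D)-R_{\mathrm{SLB}}(D)\}=0$;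 (b) if $H(\lfloor\mathbf{X}\rfloor)=\infty$, then $R(D)=\infty$ for every $D>0$.
   Context: $\log$ denotes the natural logarithm and $\Gamma$ the Gamma function. For $\mathbf{a}=(a_1,\dots,a_d)\in\mathbb{R}^d$, $\lfloor\mathbf{a}\rfloor$ denotes the vector $(\lfloor a_1\rfloor,\dots,\lfloor a_d\rfloor)\in\mathbb{Z}^d$, where $\lfloor a\rfloor$ is the largest integer not larger than $a$. $H(\cdot)$ denotes the (Shannon) entropy of a discrete random vector, which may be $+\infty$; $I(\cdot;\cdot)$ denotes mutual information. *)

theory Defs
  imports "HOL-Probability.Probability"
begin

definition is_norm :: "('a::real_vector \<Rightarrow> real) \<Rightarrow> bool" where
  "is_norm N \<longleftrightarrow> (\<forall>x. 0 \<le> N x) \<and> (\<forall>x. N x = 0 \<longleftrightarrow> x = 0) \<and>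
     (\<forall>c x. N (c *\<^sub>R x) = \<bar>c\<bar> * N x) \<and> (\<forall>x y. N (x + y) \<le> N x + N y)"

text \<open>Kullback-Leibler divergence D(P||Q) in nats, extended-real valued:
  integral of log(dP/dQ) w.r.t. P if P << Q, and +infinity otherwise.
  The integral is split into positive and negative parts (the negative part is
  always finite for probability measures).\<close>
definition KL_div :: "'a measure \<Rightarrow> 'a measure \<Rightarrow> ereal" where
  "KL_div P Q =
    (if sets P = sets Q \<and> absolutely_continuous Q P then
       (let g = (\<lambda>x. enn2real (RN_deriv Q P x)) in
         enn2ereal (\<integral>\<^sup>+ x. ennreal (ln (g x)) \<partial>P)
         - enn2ereal (\<integral>\<^sup>+ x. ennreal (- ln (g x)) \<partial>P))
     else \<infinity>)"

definition joint_dist :: "'a::topological_space measure \<Rightarrow> ('a \<Rightarrow> 'b::topological_space measure)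
    \<Rightarrow> ('a \<times> 'b) measure" where
  "joint_dist P K = P \<bind> (\<lambda>x. K x \<bind> (\<lambda>y. return (borel \<Otimes>\<^sub>M borel) (x, y)))"

definition mutual_info :: "('a::topological_space \<times> 'b::topological_space) measure \<Rightarrow> ereal" where
  "mutual_info J = KL_div J (distr J borel fst \<Otimes>\<^sub>M distr J borel snd)"

definition rate_distortion ::
    "((real^'n) \<Rightarrow> real) \<Rightarrow> ((real^'n) \<Rightarrow> real) \<Rightarrow> real \<Rightarrow> real \<Rightarrow> ereal" where
  "rate_distortion f N r D =
     (INF K \<in> {K. K \<in> borel \<rightarrow>\<^sub>M prob_algebra (borel :: (real^'n) measure) \<and>
               (\<integral>\<^sup>+ z. ennreal (N (fst z - snd z) powr r)
                    \<partial>joint_dist (density lborel (\<lambda>x. ennreal (f x))) K) \<le> ennreal D}.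
        mutual_info (joint_dist (density lborel (\<lambda>x. ennreal (f x))) K))"

definition diff_entropy :: "((real^'n) \<Rightarrow> real) \<Rightarrow> real" where
  "diff_entropy f = - (\<integral> x. f x * ln (f x) \<partial>lborel)"

definition vfloor :: "real^'n \<Rightarrow> int^'n" where
  "vfloor x = (\<chi> i. \<lfloor>x $ i\<rfloor>)"

definition floor_entropy :: "((real^'n) \<Rightarrow> real) \<Rightarrow> ennreal" where
  "floor_entropy f =
     (let p = (\<lambda>k. measure (density lborel (\<lambda>x. ennreal (f x))) (vfloor -` {k}))
      in \<integral>\<^sup>+ k. ennreal (- p k * ln (p k)) \<partial>count_space UNIV)"

definition unit_ball_vol :: "((real^'n) \<Rightarrow> real) \<Rightarrow> real" where
  "unit_ball_vol N = measure lborel {x. N x \<le> 1}"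

definition R_SLB :: "((real^'n) \<Rightarrow> real) \<Rightarrow> ((real^'n) \<Rightarrow> real) \<Rightarrow> real \<Rightarrow> real \<Rightarrow> real" where
  "R_SLB f N r D =
     (let d = real CARD('n) in
       diff_entropy f + (d / r) * ln (1 / D)
       - (d / r) * ln ((r / d) * (unit_ball_vol N * Gamma (1 + d / r)) powr (r / d) * exp 1))"

end

theory Submission
  imports Defs "HOL-Real_Asymp.Real_Asymp"
begin

text \<open>
  Let \<open>d\<close> be the dimension and \<open>P\<close> the law of the source. By the Donsker--Varadhan inequality
  \<open>\<integral> u dJ \<le> KL_div J (P \<Otimes> Q)\<close> whenever \<open>\<integral> exp u d(P \<Otimes> Q) \<le> 1\<close>, the test function
  \<open>u(x, y) = - ln (f x) - (N (x - y) / t)^r - const\<close> with \<open>t^r = r D / d\<close> gives the Shannon lower bound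
  for every \<open>D\<close>. Replacing \<open>- ln (f x)\<close> by a truncation of \<open>- ln p\<close>, with \<open>p\<close> the
  probability of the unit cell containing \<open>x\<close>, gives part (b).

  For the upper bound, use the channel \<open>X + t Z\<close> where \<open>Z\<close> has density proportional to
  \<open>exp (- N z^r)\<close>. For any reference density \<open>q\<close> its mutual information exceeds the Shannon lower
  bound by at most \<open>E (- ln (q (X + t Z))) - h(X) + \<integral> q - 1\<close>. Take \<open>q = v + \<delta> w\<close>, where \<open>v\<close> is a bounded
  continuous approximation of \<open>f\<close> and \<open>w = f * exp (- \<rho>)\<close> is a convolution with \<open>\<rho>\<close>
  subadditive. Then \<open>w (x + z) \<ge> exp (- \<rho> z) w x\<close>, and \<open>ln w\<close> is integrable because
  the floor entropy is finite; this dominates \<open>ln (q (X + t Z))\<close> as \<open>t\<close> tends to 0, so the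
  bound tends to \<open>E (- ln (q X)) - h(X) + \<integral> q - 1\<close>, which a suitable \<open>v\<close> and \<open>\<delta>\<close> make arbitrarily small.
\<close>

section \<open>Norms on Euclidean space\<close>

lemma is_normD:
  assumes "is_norm N"
  shows "0 \<le> N x" "N x = 0 \<longleftrightarrow> x = 0" "N (c *\<^sub>R x) = \<bar>c\<bar> * N x" "N (x + y) \<le> N x + N y"
  using assms unfolding is_norm_def by auto

lemma is_norm_minus: "is_norm N \<Longrightarrow> N (- x) = N x"
  using is_normD(3)[of N "-1" x] by simp

lemma is_norm_le_norm:
  fixes N :: "'a::euclidean_space \<Rightarrow> real"
  assumes N: "is_norm N"
  shows "\<exists>B>0. \<forall>x. N x \<le> B * norm x"
proof (intro exI conjI allI)
  let ?B = "(\<Sum>b\<in>Basis. N b) + 1"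
  show "0 < ?B"
    using is_normD(1)[OF N] by (intro add_nonneg_pos sum_nonneg) auto
  fix x
  have sum: "N (\<Sum>i\<in>A. g i) \<le> (\<Sum>i\<in>A. N (g i))" if "finite A" for A and g :: "'a \<Rightarrow> 'a"
    using that
  proof (induction A)
    case empty
    then show ?case using is_normD(2)[OF N, of 0] by simp
  next
    case (insert a A)
    then show ?case using is_normD(4)[OF N, of "g a" "sum g A"] by simp
  qed
  have "N x = N (\<Sum>b\<in>Basis. (x \<bullet> b) *\<^sub>R b)" by (simp add: euclidean_representation)
  also have "\<dots> \<le> (\<Sum>b\<in>Basis. N ((x \<bullet> b) *\<^sub>R b))" by (intro sum) simp
  also have "\<dots> = (\<Sum>b\<in>Basis. \<bar>x \<bullet> b\<bar> * N b)" by (simp add: is_normD(3)[OF N])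
  also have "\<dots> \<le> (\<Sum>b\<in>Basis. norm x * N b)"
    by (intro sum_mono mult_right_mono is_normD(1)[OF N] Basis_le_norm)
  also have "\<dots> = norm x * (\<Sum>b\<in>Basis. N b)" by (simp add: sum_distrib_left)
  also have "\<dots> \<le> ?B * norm x" by (simp add: algebra_simps)
  finally show "N x \<le> ?B * norm x" .
qed

lemma is_norm_continuous:
  fixes N :: "'a::euclidean_space \<Rightarrow> real"
  assumes N: "is_norm N"
  shows "continuous_on UNIV N"
proof -
  obtain B where B: "B > 0" "\<And>x. N x \<le> B * norm x" using is_norm_le_norm[OF N] by blast
  have *: "N x - N y \<le> B * norm (x - y)" for x y
    using is_normD(4)[OF N, of "x - y" y] B(2)[of "x - y"] by simp
  have "B-lipschitz_on UNIV N"
  proof (rule lipschitz_onI)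
    show "dist (N x) (N y) \<le> B * dist x y" for x y
      using *[of x y] *[of y x] by (simp add: dist_norm norm_minus_commute)
  qed (use B in simp)
  then show ?thesis by (rule lipschitz_on_continuous_on)
qed

lemma is_norm_ge_norm:
  fixes N :: "'a::euclidean_space \<Rightarrow> real"
  assumes N: "is_norm N"
  shows "\<exists>c>0. \<forall>x. c * norm x \<le> N x"
proof -
  have "compact (sphere (0::'a) 1)" "sphere (0::'a) 1 \<noteq> {}" by auto
  then obtain y where y: "y \<in> sphere 0 1" "\<And>x. x \<in> sphere 0 1 \<Longrightarrow> N y \<le> N x"
    using continuous_attains_inf[of "sphere (0::'a) 1" N]
      continuous_on_subset[OF is_norm_continuous[OF N]] by blast
  have "y \<noteq> 0" using y by auto
  then have "N y > 0" using is_normD(1,2)[OF N, of y] by auto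
  moreover have "N y * norm x \<le> N x" for x
  proof (cases "x = 0")
    case False
    have "N y \<le> N ((1 / norm x) *\<^sub>R x)" using False by (intro y(2)) simp
    also have "\<dots> = N x / norm x" by (simp add: is_normD(3)[OF N])
    finally show ?thesis using False by (simp add: field_simps)
  qed (simp add: is_normD[OF N])
  ultimately show ?thesis by blast
qed

lemma is_norm_measurable [measurable_dest]:
  fixes N :: "'a::euclidean_space \<Rightarrow> real"
  assumes N: "is_norm N"
  shows "N \<in> borel_measurable borel"
  using is_norm_continuous[OF N] by (rule borel_measurable_continuous_onI)

section \<open>Scaling, layer cake and exponential moments of a norm\<close>

lemma nn_integral_lborel_affine:
  fixes g :: "'a::euclidean_space \<Rightarrow> ennreal"
  assumes [measurable]: "g \<in> borel_measurable borel" and t: "t > 0"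
  shows "(\<integral>\<^sup>+x. g x \<partial>lborel) = ennreal (t ^ DIM('a)) * (\<integral>\<^sup>+x. g (a + t *\<^sub>R x) \<partial>lborel)"
proof -
  have "(\<integral>\<^sup>+x. g x \<partial>lborel)
      = (\<integral>\<^sup>+x. g x \<partial>(density (distr lborel borel (\<lambda>x. a + t *\<^sub>R x)) (\<lambda>_. \<bar>t\<bar>^DIM('a))))"
    using lborel_affine[of t a] t by simp
  also have "\<dots> = ennreal (t ^ DIM('a)) * (\<integral>\<^sup>+x. g (a + t *\<^sub>R x) \<partial>lborel)"
    using t by (simp add: nn_integral_density nn_integral_distr nn_integral_cmult)
  finally show ?thesis .
qed

text \<open>Comparison with the Euclidean norm puts the unit ball of \<open>N\<close> inside a
  Euclidean ball, so its volume is finite and may be written with \<open>measure\<close>. Rescaling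
  by \<open>s\<close> then gives the factor \<open>s ^ DIM('a)\<close>.\<close>

lemma emeasure_norm_ball:
  fixes N :: "'a::euclidean_space \<Rightarrow> real"
  assumes N: "is_norm N" and s: "s \<ge> 0"
  shows "emeasure lborel {x. N x \<le> s} = ennreal (s ^ DIM('a) * measure lborel {x. N x \<le> 1})"
proof -
  note [measurable] = is_norm_measurable[OF N]
  obtain c where c: "c > 0" "\<And>x. c * norm x \<le> N x" using is_norm_ge_norm[OF N] by blast
  have "{x. N x \<le> 1} \<subseteq> cball 0 (1 / c)"
  proof
    fix x assume "x \<in> {x. N x \<le> 1}"
    then have "c * norm x \<le> 1" using c(2)[of x] by simp
    then show "x \<in> cball 0 (1 / c)" using c(1) by (simp add: field_simps)
  qed
  then have "bounded {x. N x \<le> 1}" using bounded_subset bounded_cball by blast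
  then have fin: "emeasure lborel {x. N x \<le> 1} = ennreal (measure lborel {x. N x \<le> 1})"
    by (intro emeasure_eq_ennreal_measure) (use emeasure_bounded_finite[of "{x. N x \<le> 1}"] in auto)
  show ?thesis
  proof (cases "s = 0")
    case True
    have "N x \<le> s \<longleftrightarrow> x = 0" for x
      using True is_normD(1,2)[OF N, of x] by (metis order.antisym order.refl)
    then have "{x. N x \<le> s} = {0}" by auto
    then show ?thesis using True by simp
  next
    case False
    then have s: "s > 0" using s by simp
    have "emeasure lborel {x. N x \<le> s} = (\<integral>\<^sup>+x. indicator {x. N x \<le> s} x \<partial>lborel)"
      by simp
    also have "\<dots> = ennreal (s ^ DIM('a)) * (\<integral>\<^sup>+x. indicator {x. N x \<le> s} (0 + s *\<^sub>R x) \<partial>lborel)"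
      by (rule nn_integral_lborel_affine) (use s in auto)
    also have "(\<integral>\<^sup>+x. indicator {x. N x \<le> s} (0 + s *\<^sub>R x) \<partial>lborel) = (\<integral>\<^sup>+x. indicator {x. N x \<le> 1} x \<partial>lborel)"
      using s by (intro nn_integral_cong) (auto simp: indicator_def is_normD(3)[OF N])
    also have "\<dots> = ennreal (measure lborel {x. N x \<le> 1})" using fin by simp
    finally show ?thesis using s by (simp add: ennreal_mult)
  qed
qed

lemma measure_norm_ball_pos:
  fixes N :: "'a::euclidean_space \<Rightarrow> real"
  assumes N: "is_norm N"
  shows "measure lborel {x. N x \<le> 1} > 0"
proof -
  note [measurable] = is_norm_measurable[OF N]
  obtain B where B: "B > 0" "\<And>x. N x \<le> B * norm x" using is_norm_le_norm[OF N] by blast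
  have "ball 0 (1 / B) \<subseteq> {x. N x \<le> 1}"
  proof
    fix x :: 'a assume "x \<in> ball 0 (1 / B)"
    then have "B * norm x \<le> 1" using B(1) by (simp add: field_simps)
    then show "x \<in> {x. N x \<le> 1}" using B(2)[of x] by simp
  qed
  then have "emeasure lborel (ball (0::'a) (1 / B)) \<le> emeasure lborel {x. N x \<le> 1}"
    by (intro emeasure_mono) auto
  moreover have "emeasure lborel (ball (0::'a) (1 / B)) > 0"
    using content_ball_pos[of "1 / B" "0::'a"] B(1) by (simp add: measure_def enn2real_positive_iff)
  ultimately have "0 < emeasure lborel {x. N x \<le> 1}" by (rule less_le_trans[rotated])
  then show ?thesis using emeasure_norm_ball[OF N, of 1] by simp
qed

text \<open>With \<open>G t\<close> the integral of \<open>\<psi>\<close> over \<open>{t..}\<close>,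
  the left side is the integral of \<open>G (N x powr r)\<close>. Exchanging the integrals leaves
  the volume of \<open>{x. N x powr r \<le> s}\<close>, a ball of radius
  \<open>s powr (1 / r)\<close>. The exponential integrals over the space thus become
  one-dimensional Gamma integrals.\<close>

lemma nn_integral_norm_layer_cake:
  fixes N :: "'a::euclidean_space \<Rightarrow> real"
  assumes N: "is_norm N" and r: "r > 0" and [measurable]: "\<psi> \<in> borel_measurable borel"
  shows "(\<integral>\<^sup>+x. (\<integral>\<^sup>+s. \<psi> s * indicator {N x powr r..} s \<partial>lborel) \<partial>lborel) =
    ennreal (measure lborel {x. N x \<le> 1}) *
      (\<integral>\<^sup>+s. ennreal (indicator {0..} s * s powr (DIM('a) / r)) * \<psi> s \<partial>lborel)"
proof -
  note [measurable] = is_norm_measurable[OF N]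
  let ?V = "measure lborel {x. N x \<le> 1}"
  have "(\<integral>\<^sup>+x. (\<integral>\<^sup>+s. \<psi> s * indicator {N x powr r..} s \<partial>lborel) \<partial>lborel)
     = (\<integral>\<^sup>+s. (\<integral>\<^sup>+x. \<psi> s * indicator {x. N x powr r \<le> s} x \<partial>lborel) \<partial>lborel)"
    by (subst lborel_pair.Fubini') (auto simp: indicator_def intro!: nn_integral_cong)
  also have "\<dots> = (\<integral>\<^sup>+s. \<psi> s * emeasure lborel {x. N x powr r \<le> s} \<partial>lborel)"
    by (intro nn_integral_cong) (simp add: nn_integral_cmult)
  also have "\<dots> = (\<integral>\<^sup>+s. ennreal ?V * (ennreal (indicator {0..} s * s powr (DIM('a) / r)) * \<psi> s) \<partial>lborel)"
  proof (intro nn_integral_cong)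
    fix s :: real
    have "emeasure lborel {x. N x powr r \<le> s} = ennreal ?V * ennreal (indicator {0..} s * s powr (DIM('a) / r))"
    proof (cases "s \<ge> 0")
      case True
      have "{x. N x powr r \<le> s} = {x. N x \<le> s powr (1 / r)}"
      proof (intro Collect_cong)
        fix x
        have "N x powr r \<le> s \<longleftrightarrow> N x powr r \<le> (s powr (1 / r)) powr r"
          using r True by (simp add: powr_powr)
        also have "\<dots> \<longleftrightarrow> N x \<le> s powr (1 / r)"
          using r is_normD(1)[OF N, of x] by (meson linorder_not_le powr_ge_zero powr_less_mono2 powr_mono2 less_imp_le)
        finally show "N x powr r \<le> s \<longleftrightarrow> N x \<le> s powr (1 / r)" .
      qed
      moreover have "(s powr (1 / r)) ^ DIM('a) = s powr (DIM('a) / r)"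
        using True r by (cases "s = 0") (simp_all add: powr_realpow[symmetric] powr_powr)
      ultimately show ?thesis
        using True emeasure_norm_ball[OF N, of "s powr (1 / r)"] by (simp add: ennreal_mult mult.commute)
    next
      case False
      then have "{x. N x powr r \<le> s} = {}" by (auto simp: not_le intro: less_le_trans)
      then show ?thesis using False by simp
    qed
    then show "\<psi> s * emeasure lborel {x. N x powr r \<le> s} =
      ennreal ?V * (ennreal (indicator {0..} s * s powr (DIM('a) / r)) * \<psi> s)"
      by (simp add: mult_ac)
  qed
  also have "\<dots> = ennreal ?V * (\<integral>\<^sup>+s. ennreal (indicator {0..} s * s powr (DIM('a) / r)) * \<psi> s \<partial>lborel)"
    by (rule nn_integral_cmult) simp
  finally show ?thesis .
qed

text \<open>Closed form of the integral of \<open>exp (- (N x powr r))\<close>; the same constant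
  sits inside the logarithm of the Shannon lower bound.\<close>

definition norm_mass :: "('a::euclidean_space \<Rightarrow> real) \<Rightarrow> real \<Rightarrow> real" where
  "norm_mass N r = measure lborel {x. N x \<le> 1} * Gamma (1 + DIM('a) / r)"

lemma norm_mass_pos:
  fixes N :: "'a::euclidean_space \<Rightarrow> real"
  assumes N: "is_norm N" and r: "r > 0"
  shows "norm_mass N r > 0"
  unfolding norm_mass_def
  using measure_norm_ball_pos[OF N] r by (intro mult_pos_pos Gamma_real_pos add_pos_pos) auto

text \<open>Layer cake with \<open>\<psi> s = exp (- s)\<close>, whose tail integral from
  \<open>t\<close> is \<open>exp (- t)\<close>; what remains is Euler's integral for
  \<open>Gamma (1 + DIM('a) / r)\<close>.\<close>

lemma nn_integral_exp_norm:
  fixes N :: "'a::euclidean_space \<Rightarrow> real"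
  assumes N: "is_norm N" and r: "r > 0"
  shows "(\<integral>\<^sup>+x. ennreal (exp (- (N x powr r))) \<partial>lborel) = ennreal (norm_mass N r)"
proof -
  have inner: "(\<integral>\<^sup>+s. ennreal (exp (- s)) * indicator {t..} s \<partial>lborel) = ennreal (exp (- t))" for t :: real
  proof -
    have "((\<lambda>s. - exp (- s)) \<longlongrightarrow> 0) (at_top :: real filter)"
      by real_asymp
    then have "(\<integral>\<^sup>+s. ennreal (exp (- s)) * indicator {t..} s \<partial>lborel) = ennreal (0 - (- exp (- t)))"
      by (intro nn_integral_FTC_atLeast) (auto intro!: derivative_eq_intros)
    then show ?thesis by simp
  qed
  have "(\<integral>\<^sup>+x. ennreal (exp (- (N x powr r))) \<partial>lborel) =
     ennreal (measure lborel {x. N x \<le> 1}) *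
      (\<integral>\<^sup>+s. ennreal (indicator {0..} s * s powr (DIM('a) / r)) * ennreal (exp (- s)) \<partial>lborel)"
    by (subst nn_integral_norm_layer_cake[OF N r, symmetric]) (simp_all add: inner)
  also have "(\<integral>\<^sup>+s. ennreal (indicator {0..} s * s powr (DIM('a) / r)) * ennreal (exp (- s)) \<partial>lborel)
     = Gamma (1 + DIM('a) / r)"
    using r by (subst Gamma_conv_nn_integral_real)
      (auto intro!: nn_integral_cong simp: ennreal_mult[symmetric] exp_minus field_simps add_pos_nonneg)
  finally show ?thesis
    using r Gamma_real_pos[of "1 + DIM('a) / r"] by (simp add: norm_mass_def ennreal_mult add_pos_pos less_imp_le)
qed

text \<open>Layer cake with \<open>\<psi> s = s * exp (- s)\<close>, whose tail integral from
  \<open>t\<close> is \<open>(t + 1) * exp (- t)\<close>. This yields the wanted integral plus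
  \<open>norm_mass N r\<close>; the recursion of Gamma splits the value accordingly, and the extra
  mass is cancelled.\<close>

lemma nn_integral_norm_exp_norm:
  fixes N :: "'a::euclidean_space \<Rightarrow> real"
  assumes N: "is_norm N" and r: "r > 0"
  shows "(\<integral>\<^sup>+x. ennreal (N x powr r * exp (- (N x powr r))) \<partial>lborel) =
    ennreal (DIM('a) / r * norm_mass N r)"
proof -
  note [measurable] = is_norm_measurable[OF N]
  let ?V = "measure lborel {x. N x \<le> 1}" and ?a = "DIM('a) / r"
  have a: "?a > 0" using r by simp
  then have \<Gamma>: "Gamma (1 + ?a) \<ge> 0" by (intro less_imp_le Gamma_real_pos) simp
  have inner: "(\<integral>\<^sup>+s. ennreal (indicator {0..} s * s * exp (- s)) * indicator {t..} s \<partial>lborel)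
      = ennreal (t * exp (- t)) + ennreal (exp (- t))" if "t \<ge> 0" for t :: real
  proof -
    have "((\<lambda>s. - (s + 1) * exp (- s)) \<longlongrightarrow> 0) (at_top :: real filter)"
      by real_asymp
    then have "(\<integral>\<^sup>+s. ennreal (s * exp (- s)) * indicator {t..} s \<partial>lborel) = ennreal (0 - (- (t + 1) * exp (- t)))"
      using that by (intro nn_integral_FTC_atLeast) (auto intro!: derivative_eq_intros simp: algebra_simps)
    also have "(\<integral>\<^sup>+s. ennreal (s * exp (- s)) * indicator {t..} s \<partial>lborel)
       = (\<integral>\<^sup>+s. ennreal (indicator {0..} s * s * exp (- s)) * indicator {t..} s \<partial>lborel)"
      using that by (intro nn_integral_cong) (auto simp: indicator_def)
    finally show ?thesis using that by (simp add: ennreal_plus[symmetric] algebra_simps del: ennreal_plus)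
  qed
  have "(\<integral>\<^sup>+x. ennreal (N x powr r * exp (- (N x powr r))) \<partial>lborel) + ennreal (?V * Gamma (1 + ?a))
     = (\<integral>\<^sup>+x. ennreal (N x powr r * exp (- (N x powr r))) + ennreal (exp (- (N x powr r))) \<partial>lborel)"
    by (subst nn_integral_add) (simp_all add: nn_integral_exp_norm[OF N r] norm_mass_def)
  also have "\<dots> = ennreal ?V *
      (\<integral>\<^sup>+s. ennreal (indicator {0..} s * s powr ?a) * ennreal (indicator {0..} s * s * exp (- s)) \<partial>lborel)"
    by (subst nn_integral_norm_layer_cake[OF N r, symmetric]) (simp_all add: inner)
  also have "(\<integral>\<^sup>+s. ennreal (indicator {0..} s * s powr ?a) * ennreal (indicator {0..} s * s * exp (- s)) \<partial>lborel)
     = Gamma (2 + ?a)"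
    using a by (subst Gamma_conv_nn_integral_real)
      (auto intro!: nn_integral_cong simp: ennreal_mult[symmetric] exp_minus field_simps indicator_def powr_mult_base add.commute)
  also have "Gamma (2 + ?a) = (1 + ?a) * Gamma (1 + ?a)"
    using Gamma_plus1[of "1 + ?a"] a by (simp add: add.assoc nonpos_Ints_def) 
  also have "ennreal ?V * ennreal ((1 + ?a) * Gamma (1 + ?a)) =
    ennreal (?a * (?V * Gamma (1 + ?a))) + ennreal (?V * Gamma (1 + ?a))"
  proof -
    have "ennreal (?a * (?V * Gamma (1 + ?a))) + ennreal (?V * Gamma (1 + ?a))
        = ennreal (?a * (?V * Gamma (1 + ?a)) + ?V * Gamma (1 + ?a))"
      by (intro ennreal_plus[symmetric] mult_nonneg_nonneg) (use a \<Gamma> in auto)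
    also have "\<dots> = ennreal (?V * ((1 + ?a) * Gamma (1 + ?a)))"
      by (simp add: algebra_simps)
    also have "\<dots> = ennreal ?V * ennreal ((1 + ?a) * Gamma (1 + ?a))"
      by (rule ennreal_mult) (use a \<Gamma> in auto)
    finally show ?thesis ..
  qed
  finally show ?thesis unfolding norm_mass_def by (simp add: ennreal_add_left_cancel add.commute[of _ "ennreal (?V * Gamma (1 + ?a))"])
qed

section \<open>Divergence\<close>

text \<open>Radon-Nikodym derivatives agree almost everywhere, so the divergence may be computed
  from any explicit density instead of the one chosen by \<open>RN_deriv\<close>.\<close>

lemma KL_div_density:
  assumes "sigma_finite_measure Q" and [measurable]: "g \<in> borel_measurable Q"
    and g0: "\<And>x. g x \<ge> 0" and P: "P = density Q (\<lambda>x. ennreal (g x))"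
  shows "KL_div P Q = enn2ereal (\<integral>\<^sup>+x. ennreal (ln (g x)) \<partial>P) - enn2ereal (\<integral>\<^sup>+x. ennreal (- ln (g x)) \<partial>P)"
proof -
  interpret sigma_finite_measure Q by fact
  have ac: "absolutely_continuous Q P" unfolding P by (intro absolutely_continuousI_density) simp
  have "AE x in Q. ennreal (g x) = RN_deriv Q P x"
    by (rule RN_deriv_unique) (simp_all add: P)
  then have "AE x in Q. enn2real (RN_deriv Q P x) = g x"
    by eventually_elim (use g0 in \<open>metis enn2real_ennreal\<close>)
  then have ae: "AE x in P. enn2real (RN_deriv Q P x) = g x"
    by (rule absolutely_continuous_AE[OF _ ac, rotated]) (simp add: P)
  have "(\<integral>\<^sup>+x. ennreal (ln (enn2real (RN_deriv Q P x))) \<partial>P) = (\<integral>\<^sup>+x. ennreal (ln (g x)) \<partial>P)"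
    "(\<integral>\<^sup>+x. ennreal (- ln (enn2real (RN_deriv Q P x))) \<partial>P) = (\<integral>\<^sup>+x. ennreal (- ln (g x)) \<partial>P)"
    using ae by (auto intro!: nn_integral_cong_AE elim!: eventually_mono)
  then show ?thesis using ac by (simp add: KL_div_def P)
qed

text \<open>From \<open>ln y \<le> y - 1\<close> at \<open>y = 1 / g x\<close>,
  \<open>- g x * ln (g x)\<close> is at most \<open>1 - g x\<close>, hence at most 1. For a
  probability measure \<open>Q\<close> the negative part of the divergence is therefore
  finite.\<close>

lemma nn_integral_neg_ln_density_le:
  assumes [measurable]: "g \<in> borel_measurable Q"
    and g0: "\<And>x. g x \<ge> 0" and P: "P = density Q (\<lambda>x. ennreal (g x))"
  shows "(\<integral>\<^sup>+x. ennreal (- ln (g x)) \<partial>P) \<le> emeasure Q (space Q)"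
proof -
  have "(\<integral>\<^sup>+x. ennreal (- ln (g x)) \<partial>P) = (\<integral>\<^sup>+x. ennreal (g x) * ennreal (- ln (g x)) \<partial>Q)"
    unfolding P by (simp add: nn_integral_density)
  also have "\<dots> \<le> (\<integral>\<^sup>+x. 1 \<partial>Q)"
  proof (intro nn_integral_mono)
    fix x
    show "ennreal (g x) * ennreal (- ln (g x)) \<le> 1"
    proof (cases "g x > 0")
      case True
      have "- ln (g x) = ln (1 / g x)" using True by (simp add: ln_div)
      also have "\<dots> \<le> 1 / g x - 1" using True by (intro ln_le_minus_one) simp
      finally have "g x * (- ln (g x)) \<le> g x * (1 / g x - 1)" using True by (intro mult_left_mono) auto
      also have "\<dots> \<le> 1" using True by (simp add: field_simps)
      finally show ?thesis using g0[of x] by (simp add: ennreal_mult'[symmetric] flip: ennreal_1)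
    next
      case False
      then have "g x = 0" using g0[of x] by simp
      then show ?thesis by simp
    qed
  qed
  finally show ?thesis by simp
qed

lemma AE_density_pos:
  assumes [measurable]: "g \<in> borel_measurable Q"
    and g0: "\<And>x. g x \<ge> (0::real)" and P: "P = density Q (\<lambda>x. ennreal (g x))"
  shows "AE x in P. g x > 0"
  unfolding P by (subst AE_density) (auto simp: order_le_less)

lemma KL_div_density_integral:
  assumes "sigma_finite_measure Q" and [measurable]: "g \<in> borel_measurable Q"
    and g0: "\<And>x. g x \<ge> 0" and P: "P = density Q (\<lambda>x. ennreal (g x))"
    and int: "integrable P (\<lambda>x. ln (g x))"
  shows "KL_div P Q = ereal (\<integral>x. ln (g x) \<partial>P)"
proof -
  have "(\<integral>\<^sup>+x. ennreal (ln (g x)) \<partial>P) < \<infinity>" "(\<integral>\<^sup>+x. ennreal (- ln (g x)) \<partial>P) < \<infinity>"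
    using int unfolding real_integrable_def by (auto simp: less_top)
  then obtain a b where ab: "(\<integral>\<^sup>+x. ennreal (ln (g x)) \<partial>P) = ennreal a" "a \<ge> 0"
    "(\<integral>\<^sup>+x. ennreal (- ln (g x)) \<partial>P) = ennreal b" "b \<ge> 0"
    by (metis ennreal_cases less_irrefl infinity_ennreal_def)
  show ?thesis
    unfolding KL_div_density[OF assms(1-4)] real_lebesgue_integral_def[OF int] ab
    using ab by simp
qed

text \<open>Donsker-Varadhan: integrate \<open>ln y \<le> y - 1\<close> at
  \<open>y = exp (u x) / g x\<close>, where \<open>g\<close> is the density of \<open>P\<close> with
  respect to \<open>Q\<close>. The mean of this \<open>y\<close> under \<open>P\<close> is at most
  that of \<open>exp (u x)\<close> under \<open>Q\<close>, hence at most 1, so the right side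
  integrates to at most 0.\<close>

lemma KL_div_ge_integral:
  fixes u :: "'a \<Rightarrow> real"
  assumes "prob_space P" "prob_space Q" and [measurable]: "u \<in> borel_measurable Q"
    and exp_u: "(\<integral>\<^sup>+x. ennreal (exp (u x)) \<partial>Q) \<le> 1" and int_u: "integrable P u"
  shows "ereal (\<integral>x. u x \<partial>P) \<le> KL_div P Q"
proof (cases "sets P = sets Q \<and> absolutely_continuous Q P")
  case False
  then show ?thesis by (auto simp: KL_div_def)
next
  case True
  then have sets_eq [measurable_cong]: "sets P = sets Q" and ac: "absolutely_continuous Q P" by auto
  interpret P: prob_space P by fact
  interpret Q: prob_space Q by fact
  define g where "g x = enn2real (RN_deriv Q P x)" for x
  have [measurable]: "g \<in> borel_measurable Q" unfolding g_def by simp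
  have g0: "g x \<ge> 0" for x unfolding g_def by simp
  have "AE x in Q. RN_deriv Q P x = ennreal (g x)"
    using Q.RN_deriv_finite[OF P.sigma_finite_measure_axioms ac sets_eq]
    by eventually_elim (simp add: g_def less_top)
  then have P: "P = density Q (\<lambda>x. ennreal (g x))"
    using Q.density_RN_deriv[OF ac sets_eq] by (metis borel_measurable_RN_deriv density_cong
        \<open>g \<in> borel_measurable Q\<close> measurable_compose_rev measurable_ennreal)
  note KL = KL_div_density[OF Q.sigma_finite_measure_axioms \<open>g \<in> borel_measurable Q\<close> g0 P]
  \<comment> \<open>This rules out \<open>\<infinity> - \<infinity>\<close>: the divergence is
    either \<open>\<infinity>\<close> or a genuine integral of \<open>ln (g x)\<close>.\<close>
  have neg: "(\<integral>\<^sup>+x. ennreal (- ln (g x)) \<partial>P) < \<infinity>"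
    using nn_integral_neg_ln_density_le[OF \<open>g \<in> borel_measurable Q\<close> g0 P]
    by (simp add: Q.emeasure_space_1 order_le_less_trans)
  show ?thesis
  proof (cases "(\<integral>\<^sup>+x. ennreal (ln (g x)) \<partial>P) = \<infinity>")
    case True
    then show ?thesis using neg by (simp add: KL enn2ereal_eq_top_iff less_top)
  next
    case False
    then have int: "integrable P (\<lambda>x. ln (g x))"
      using neg unfolding real_integrable_def by (auto simp: less_top)
    have bound: "(\<integral>\<^sup>+x. ennreal (exp (u x) / g x) \<partial>P) \<le> 1"
    proof -
      have "(\<integral>\<^sup>+x. ennreal (exp (u x) / g x) \<partial>P) = (\<integral>\<^sup>+x. ennreal (g x) * ennreal (exp (u x) / g x) \<partial>Q)"
        by (subst (1) P) (simp add: nn_integral_density)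
      \<comment> \<open>Only an inequality: where \<open>g x = 0\<close> the left integrand is 0,
        while \<open>exp (u x)\<close> is positive.\<close>
      also have "\<dots> \<le> (\<integral>\<^sup>+x. ennreal (exp (u x)) \<partial>Q)"
        using g0 by (intro nn_integral_mono) (auto simp: ennreal_mult''[symmetric] intro!: ennreal_leI)
      finally show ?thesis using exp_u by simp
    qed
    then have int2: "integrable P (\<lambda>x. exp (u x) / g x)"
      using g0 by (intro integrableI_nonneg) (auto simp: order_le_less_trans)
    have "(\<integral>x. u x \<partial>P) - (\<integral>x. ln (g x) \<partial>P) = (\<integral>x. u x - ln (g x) \<partial>P)"
      using int int_u by simp
    also have "\<dots> \<le> (\<integral>x. exp (u x) / g x - 1 \<partial>P)"
    proof (intro integral_mono_AE)
      show "AE x in P. u x - ln (g x) \<le> exp (u x) / g x - 1"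
        using AE_density_pos[OF \<open>g \<in> borel_measurable Q\<close> g0 P]
      proof eventually_elim
        case (elim x)
        then have "u x - ln (g x) = ln (exp (u x) / g x)" by (simp add: ln_div)
        also have "\<dots> \<le> exp (u x) / g x - 1" using elim by (intro ln_le_minus_one) simp
        finally show ?case .
      qed
    qed (use int int_u int2 in auto)
    also have "\<dots> = (\<integral>x. exp (u x) / g x \<partial>P) - 1"
      using int2 by (simp add: P.prob_space)
    also have "\<dots> \<le> 0"
      using g0 bound int2 by (simp add: nn_integral_eq_integral flip: ennreal_1)
    finally show ?thesis
      using KL_div_density_integral[OF Q.sigma_finite_measure_axioms \<open>g \<in> borel_measurable Q\<close> g0 P int]
      by simp
  qed
qed

section \<open>Joint distributions\<close>

lemma joint_dist_kernel_measurable: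
  fixes K :: "'a::second_countable_topology \<Rightarrow> 'b::second_countable_topology measure"
  assumes K: "K \<in> borel \<rightarrow>\<^sub>M prob_algebra borel"
  shows "(\<lambda>x. K x \<bind> (\<lambda>y. return (borel \<Otimes>\<^sub>M borel) (x, y))) \<in> borel \<rightarrow>\<^sub>M prob_algebra (borel \<Otimes>\<^sub>M borel)"
proof (rule measurable_bind_prob_space2[OF K])
  show "(\<lambda>(x, y). return (borel \<Otimes>\<^sub>M borel) (x, y)) \<in> borel \<Otimes>\<^sub>M borel \<rightarrow>\<^sub>M prob_algebra (borel \<Otimes>\<^sub>M borel)"
    using measurable_return_prob_space by simp
qed

text \<open>Unfolds the monadic bind into iterated integrals and the first marginal; later
  computations with \<open>joint_dist\<close> go through these facts.\<close>

lemma
  fixes K :: "'a::second_countable_topology \<Rightarrow> 'b::second_countable_topology measure"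
  assumes P: "prob_space P" "sets P = sets borel" and K: "K \<in> borel \<rightarrow>\<^sub>M prob_algebra borel"
  shows sets_joint_dist: "sets (joint_dist P K) = sets (borel \<Otimes>\<^sub>M borel)"
    and prob_space_joint_dist: "prob_space (joint_dist P K)"
    and nn_integral_joint_dist: "\<And>g. g \<in> borel_measurable (borel \<Otimes>\<^sub>M borel) \<Longrightarrow>
      (\<integral>\<^sup>+z. g z \<partial>joint_dist P K) = (\<integral>\<^sup>+x. (\<integral>\<^sup>+y. g (x, y) \<partial>K x) \<partial>P)"
    and distr_joint_dist_fst: "distr (joint_dist P K) borel fst = P"
proof -
  note M = joint_dist_kernel_measurable[OF K]
  have Pin: "P \<in> space (prob_algebra borel)" using P by (simp add: space_prob_algebra)
  show sets: "sets (joint_dist P K) = sets (borel \<Otimes>\<^sub>M borel)"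
    unfolding joint_dist_def by (rule sets_bind'[OF Pin M])
  show "prob_space (joint_dist P K)"
    unfolding joint_dist_def by (rule prob_space_bind'[OF Pin M])
  have MP: "(\<lambda>x. K x \<bind> (\<lambda>y. return (borel \<Otimes>\<^sub>M borel) (x, y))) \<in> P \<rightarrow>\<^sub>M subprob_algebra (borel \<Otimes>\<^sub>M borel)"
    using measurable_prob_algebraD[OF M] P(2) by (simp cong: measurable_cong_sets)
  have KM: "sets (K x) = sets borel" "prob_space (K x)" for x
    using measurable_space[OF K, of x] by (auto simp: space_prob_algebra)
  show nn: "(\<integral>\<^sup>+z. g z \<partial>joint_dist P K) = (\<integral>\<^sup>+x. (\<integral>\<^sup>+y. g (x, y) \<partial>K x) \<partial>P)"
    if [measurable]: "g \<in> borel_measurable (borel \<Otimes>\<^sub>M borel)" for g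
  proof -
    have "(\<integral>\<^sup>+z. g z \<partial>joint_dist P K)
        = (\<integral>\<^sup>+x. (\<integral>\<^sup>+z. g z \<partial>(K x \<bind> (\<lambda>y. return (borel \<Otimes>\<^sub>M borel) (x, y)))) \<partial>P)"
      unfolding joint_dist_def by (rule nn_integral_bind[OF that MP])
    also have "\<dots> = (\<integral>\<^sup>+x. (\<integral>\<^sup>+y. g (x, y) \<partial>K x) \<partial>P)"
    proof (intro nn_integral_cong)
      fix x
      note [measurable_cong] = KM(1)[of x]
      have "(\<lambda>y. return (borel \<Otimes>\<^sub>M borel) (x, y)) \<in> K x \<rightarrow>\<^sub>M subprob_algebra (borel \<Otimes>\<^sub>M borel)"
        by measurable
      then have "(\<integral>\<^sup>+z. g z \<partial>(K x \<bind> (\<lambda>y. return (borel \<Otimes>\<^sub>M borel) (x, y))))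
          = (\<integral>\<^sup>+y. (\<integral>\<^sup>+z. g z \<partial>return (borel \<Otimes>\<^sub>M borel) (x, y)) \<partial>K x)"
        by (rule nn_integral_bind[OF that])
      also have "\<dots> = (\<integral>\<^sup>+y. g (x, y) \<partial>K x)"
        by (intro nn_integral_cong nn_integral_return) (auto simp: space_pair_measure)
      finally show "(\<integral>\<^sup>+z. g z \<partial>(K x \<bind> (\<lambda>y. return (borel \<Otimes>\<^sub>M borel) (x, y)))) = (\<integral>\<^sup>+y. g (x, y) \<partial>K x)" .
    qed
    finally show ?thesis .
  qed
  show "distr (joint_dist P K) borel fst = P"
  proof (rule measure_eqI)
    fix A assume "A \<in> sets (distr (joint_dist P K) borel fst)"
    then have [measurable]: "A \<in> sets borel" by simp
    have [measurable]: "fst \<in> joint_dist P K \<rightarrow>\<^sub>M borel"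
      using sets by (simp cong: measurable_cong_sets)
    have "emeasure (distr (joint_dist P K) borel fst) A = (\<integral>\<^sup>+z. indicator A z \<partial>distr (joint_dist P K) borel fst)"
      by simp
    also have "\<dots> = (\<integral>\<^sup>+z. indicator A (fst z) \<partial>joint_dist P K)"
      by (rule nn_integral_distr) auto
    also have "\<dots> = (\<integral>\<^sup>+x. (\<integral>\<^sup>+y. indicator A x \<partial>K x) \<partial>P)"
      by (subst nn) auto
    also have "\<dots> = (\<integral>\<^sup>+x. indicator A x \<partial>P)"
      by (intro nn_integral_cong) (simp add: prob_space.emeasure_space_1[OF KM(2)])
    also have "\<dots> = emeasure P A" using P(2) by (simp add: nn_integral_indicator)
    finally show "emeasure (distr (joint_dist P K) borel fst) A = emeasure P A" .
  qed (simp add: P)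
qed

text \<open>Both lower bounds come from this estimate: \<open>s = - ln f\<close> gives the Shannon
  bound, and truncated cell information gives the infinite case. The divergence inequality is
  applied to \<open>s (fst z) - a * N (fst z - snd z) powr r - c\<close>. The output law is
  arbitrary, so the exponential moment is bounded for each fixed \<open>y\<close>.\<close>

lemma mutual_info_ge:
  fixes K :: "'a::euclidean_space \<Rightarrow> 'a measure" and s :: "'a \<Rightarrow> real"
  assumes P: "prob_space P" "sets P = sets borel" and K: "K \<in> borel \<rightarrow>\<^sub>M prob_algebra borel"
    and N: "is_norm N" and s: "integrable P s" and a: "a \<ge> 0" and D: "D \<ge> 0"
    and dist: "(\<integral>\<^sup>+z. ennreal (N (fst z - snd z) powr r) \<partial>joint_dist P K) \<le> ennreal D"
    and bound: "\<And>y. (\<integral>\<^sup>+x. ennreal (exp (s x - a * N (x - y) powr r)) \<partial>P) \<le> ennreal (exp c)"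
  shows "ereal ((\<integral>x. s x \<partial>P) - c - a * D) \<le> mutual_info (joint_dist P K)"
proof -
  note [measurable] = is_norm_measurable[OF N]
  let ?J = "joint_dist P K"
  interpret P: prob_space P by fact
  interpret J: prob_space ?J by (rule prob_space_joint_dist[OF P K])
  note [measurable_cong] = P(2) sets_joint_dist[OF P K]
  have [measurable]: "s \<in> borel_measurable borel"
    using borel_measurable_integrable[OF s] by simp
  let ?Q = "distr ?J borel snd"
  interpret Q: prob_space ?Q by (rule J.prob_space_distr) simp
  interpret PQ: pair_prob_space P ?Q ..
  define u where "u z = s (fst z) - a * N (fst z - snd z) powr r - c" for z
  have [measurable]: "u \<in> borel_measurable (borel \<Otimes>\<^sub>M borel)" unfolding u_def by measurable
  have s': "integrable ?J (\<lambda>z. s (fst z))" "(\<integral>z. s (fst z) \<partial>?J) = (\<integral>x. s x \<partial>P)"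
    using s integral_distr[of fst ?J borel s] distr_joint_dist_fst[OF P K]
      integrable_distr_eq[of fst ?J borel s] by simp_all
  have n: "integrable ?J (\<lambda>z. N (fst z - snd z) powr r)"
    using dist by (intro integrableI_nonneg) (auto intro: order_le_less_trans)
  then have "ennreal (\<integral>z. N (fst z - snd z) powr r \<partial>?J) \<le> ennreal D"
    using dist by (subst (asm) nn_integral_eq_integral) auto
  then have "(\<integral>z. N (fst z - snd z) powr r \<partial>?J) \<le> D" using D by simp
  moreover have "(\<integral>z. u z \<partial>?J) = (\<integral>x. s x \<partial>P) - a * (\<integral>z. N (fst z - snd z) powr r \<partial>?J) - c"
    using s' n by (simp add: u_def J.prob_space)
  ultimately have "(\<integral>x. s x \<partial>P) - c - a * D \<le> (\<integral>z. u z \<partial>?J)"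
    using a by (simp add: mult_left_mono)
  also have "ereal \<dots> \<le> KL_div ?J (P \<Otimes>\<^sub>M ?Q)"
  proof (rule KL_div_ge_integral)
    show "integrable ?J u" unfolding u_def using s' n by auto
    \<comment> \<open>Tonelli, with the source variable innermost so that \<open>bound\<close>
      applies at each \<open>y\<close>.\<close>
    have "(\<integral>\<^sup>+z. ennreal (exp (u z)) \<partial>(P \<Otimes>\<^sub>M ?Q)) = (\<integral>\<^sup>+y. (\<integral>\<^sup>+x. ennreal (exp (u (x, y))) \<partial>P) \<partial>?Q)"
      by (subst PQ.nn_integral_snd[symmetric]) (auto simp: case_prod_unfold)
    also have "\<dots> \<le> (\<integral>\<^sup>+y. 1 \<partial>?Q)"
    proof (intro nn_integral_mono)
      fix y
      have "(\<integral>\<^sup>+x. ennreal (exp (u (x, y))) \<partial>P)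
          = (\<integral>\<^sup>+x. ennreal (exp (- c)) * ennreal (exp (s x - a * N (x - y) powr r)) \<partial>P)"
        by (intro nn_integral_cong) (simp add: u_def ennreal_mult[symmetric] exp_add[symmetric])
      also have "\<dots> = ennreal (exp (- c)) * (\<integral>\<^sup>+x. ennreal (exp (s x - a * N (x - y) powr r)) \<partial>P)"
        by (intro nn_integral_cmult) measurable
      also have "\<dots> \<le> ennreal (exp (- c)) * ennreal (exp c)"
        by (intro mult_left_mono bound) simp
      also have "\<dots> = 1" by (simp add: ennreal_mult[symmetric] exp_add[symmetric])
      finally show "(\<integral>\<^sup>+x. ennreal (exp (u (x, y))) \<partial>P) \<le> 1" .
    qed
    also have "\<dots> = 1" using Q.emeasure_space_1 by simp
    finally show "(\<integral>\<^sup>+z. ennreal (exp (u z)) \<partial>(P \<Otimes>\<^sub>M ?Q)) \<le> 1" .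
  qed (use J.prob_space_axioms PQ.prob_space_axioms in simp_all)
  also have "\<dots> = mutual_info ?J"
    unfolding mutual_info_def by (simp add: distr_joint_dist_fst[OF P K])
  finally show ?thesis by simp
qed

section \<open>The Shannon lower bound\<close>

lemma nn_integral_exp_norm_scaled:
  fixes N :: "'a::euclidean_space \<Rightarrow> real"
  assumes N: "is_norm N" and r: "r > 0" and t: "t > 0"
  shows "(\<integral>\<^sup>+x. ennreal (exp (- (t powr (- r) * N (x - y) powr r))) \<partial>lborel) =
    ennreal (t ^ DIM('a) * norm_mass N r)"
proof -
  note [measurable] = is_norm_measurable[OF N]
  have "t powr (- r) * (t * N x) powr r = N x powr r" for x
    using t is_normD(1)[OF N, of x] by (simp add: powr_mult powr_minus field_simps)
  then have "(\<integral>\<^sup>+x. ennreal (exp (- (t powr (- r) * N (x - y) powr r))) \<partial>lborel)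
      = ennreal (t ^ DIM('a)) * (\<integral>\<^sup>+x. ennreal (exp (- (N x powr r))) \<partial>lborel)"
    using t by (subst nn_integral_lborel_affine[of _ t y]) (simp_all add: is_normD(3)[OF N])
  then show ?thesis
    using t by (simp add: nn_integral_exp_norm[OF N r] ennreal_mult')
qed

text \<open>For \<open>Z\<close> with density \<open>exp (- (N z powr r)) / norm_mass N r\<close>,
  the terms subtracted from \<open>diff_entropy f\<close> add up to the differential entropy of
  \<open>t *\<^sub>R Z\<close>, and this \<open>t\<close> makes its moment of order \<open>r\<close>
  equal to \<open>D\<close>. Both bounds on the rate are proved in this form.\<close>

lemma R_SLB_alt:
  fixes N :: "real^'n \<Rightarrow> real"
  assumes N: "is_norm N" and r: "r > 0" and D: "D > 0"
  defines "t \<equiv> (r * D / CARD('n)) powr (1 / r)"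
  shows "R_SLB f N r D = diff_entropy f - CARD('n) / r
    - ln (t ^ CARD('n) * norm_mass N r)"
proof -
  define d where "d = real CARD('n)"
  have d: "d > 0" by (simp add: d_def)
  define A where "A = norm_mass N r"
  have A: "A > 0" using norm_mass_pos[OF N r] by (simp add: A_def)
  have t: "t > 0" using r D by (simp add: t_def)
  have "ln (t ^ CARD('n) * A) = d * ln t + ln A"
    using A t by (simp add: ln_mult ln_realpow d_def)
  also have "ln t = (ln r + ln D - ln d) / r"
    using r D d by (simp add: t_def d_def[symmetric] ln_powr ln_div ln_mult)
  finally have 1: "ln (t ^ CARD('n) * A) = d / r * (ln r + ln D - ln d) + ln A" by simp
  have "ln (r / d * A powr (r / d) * exp 1) = ln r - ln d + r / d * ln A + 1"
    using r d A by (simp add: ln_mult ln_div ln_powr)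
  then have "R_SLB f N r D = diff_entropy f + d / r * ln (1 / D) - d / r * (ln r - ln d + r / d * ln A + 1)"
    by (simp add: R_SLB_def Let_def d_def A_def unit_ball_vol_def norm_mass_def)
  also have "\<dots> = diff_entropy f - d / r - (d / r * (ln r + ln D - ln d) + ln A)"
    using r d D by (simp add: ln_div field_simps)
  also have "\<dots> = diff_entropy f - d / r - ln (t ^ CARD('n) * A)" by (simp only: 1)
  finally show ?thesis by (simp add: A_def d_def)
qed

text \<open>In \<open>mutual_info_ge\<close> with \<open>s = - ln f\<close>, the weight
  \<open>f\<close> cancels \<open>exp s\<close>. What remains is a Lebesgue integral of the scaled
  exponential of the norm, whose value is the same for every \<open>y\<close> by translation
  invariance.\<close>

lemma R_SLB_le_rate_distortion:
  fixes f N :: "real^'n \<Rightarrow> real"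
  assumes N: "is_norm N" and r: "r > 0" and [measurable]: "f \<in> borel_measurable borel"
    and f0: "\<And>x. f x \<ge> 0" and f1: "(\<integral>\<^sup>+x. ennreal (f x) \<partial>lborel) = 1"
    and int: "integrable lborel (\<lambda>x. f x * ln (f x))" and D: "D > 0"
  shows "ereal (R_SLB f N r D) \<le> rate_distortion f N r D"
  unfolding rate_distortion_def
proof (rule INF_greatest, safe)
  note [measurable] = is_norm_measurable[OF N]
  let ?P = "density lborel (\<lambda>x. ennreal (f x))"
  fix K :: "real^'n \<Rightarrow> (real^'n) measure"
  assume K: "K \<in> borel \<rightarrow>\<^sub>M prob_algebra borel"
    and dist: "(\<integral>\<^sup>+z. ennreal (N (fst z - snd z) powr r) \<partial>joint_dist ?P K) \<le> ennreal D"
  have P: "prob_space ?P" "sets ?P = sets borel"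
    using f1 by (auto intro!: prob_spaceI simp: emeasure_density)
  define t where "t = (r * D / CARD('n)) powr (1 / r)"
  have t: "t > 0" using r D by (simp add: t_def)
  define A where "A = t ^ CARD('n) * norm_mass N r"
  have A: "A > 0" using norm_mass_pos[OF N r] t by (simp add: A_def)
  \<comment> \<open>The multiplier \<open>a = t powr (- r)\<close> makes the distortion term
    \<open>a * D\<close> equal to the summand \<open>CARD('n) / r\<close> of
    \<open>R_SLB_alt\<close>.\<close>
  have "t powr (- r) * D = CARD('n) / r"
    using r D by (simp add: t_def powr_powr powr_minus)
  moreover have "(\<integral>x. - ln (f x) \<partial>?P) = diff_entropy f"
    using f0 by (simp add: diff_entropy_def integral_density)
  moreover have "ereal ((\<integral>x. - ln (f x) \<partial>?P) - ln A - t powr (- r) * D) \<le> mutual_info (joint_dist ?P K)"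
  proof (rule mutual_info_ge[OF P K N _ _ _ dist])
    show "integrable ?P (\<lambda>x. - ln (f x))"
      using int f0 by (subst integrable_density) auto
    fix y
    have "(\<integral>\<^sup>+x. ennreal (exp (- ln (f x) - t powr (- r) * N (x - y) powr r)) \<partial>?P)
        = (\<integral>\<^sup>+x. ennreal (f x) * ennreal (exp (- ln (f x) - t powr (- r) * N (x - y) powr r)) \<partial>lborel)"
      by (simp add: nn_integral_density)
    also have "\<dots> \<le> (\<integral>\<^sup>+x. ennreal (exp (- (t powr (- r) * N (x - y) powr r))) \<partial>lborel)"
    proof (intro nn_integral_mono)
      fix x
      \<comment> \<open>Equality where \<open>f x > 0\<close>; where \<open>f x = 0\<close> the left
        side is 0.\<close>
      have "f x * exp (- ln (f x)) \<le> 1"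
        using f0[of x] by (cases "f x = 0") (simp_all add: exp_minus)
      then have "(f x * exp (- ln (f x))) * exp (- (t powr (- r) * N (x - y) powr r))
          \<le> 1 * exp (- (t powr (- r) * N (x - y) powr r))"
        by (intro mult_right_mono) auto
      then show "ennreal (f x) * ennreal (exp (- ln (f x) - t powr (- r) * N (x - y) powr r))
          \<le> ennreal (exp (- (t powr (- r) * N (x - y) powr r)))"
        using f0[of x] by (simp add: ennreal_mult[symmetric] exp_diff exp_minus divide_simps)
    qed
    also have "\<dots> = ennreal (exp (ln A))"
      using nn_integral_exp_norm_scaled[OF N r t, of y] A by (simp add: A_def)
    finally show "(\<integral>\<^sup>+x. ennreal (exp (- ln (f x) - t powr (- r) * N (x - y) powr r)) \<partial>?P) \<le> ennreal (exp (ln A))" .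
  qed (use D in auto)
  ultimately show "ereal (R_SLB f N r D) \<le> mutual_info (joint_dist ?P K)"
    unfolding R_SLB_alt[OF N r D] t_def[symmetric] A_def[symmetric] by (simp add: algebra_simps)
qed

section \<open>Unit cells and sources of infinite floor entropy\<close>

lemma countable_UNIV_int_vec: "countable (UNIV :: (int^'n) set)"
  by (rule countableI'[of "\<lambda>x. to_nat (vec_nth x)"]) (auto simp: inj_on_def vec_nth_inject)

lemma vfloor_measurable [measurable]: "vfloor \<in> borel \<rightarrow>\<^sub>M count_space (UNIV :: (int^'n) set)"
proof -
  have "vfloor -` {k} \<in> sets borel" for k :: "int^'n"
  proof -
    have "vfloor -` {k} = {x. \<forall>i. \<lfloor>x $ i\<rfloor> = k $ i}"
      by (auto simp: vfloor_def vec_eq_iff)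
    also have "\<dots> \<in> sets borel" by measurable
    finally show ?thesis .
  qed
  then show ?thesis by (simp add: measurable_count_space_eq_countable countable_UNIV_int_vec)
qed

lemma vfloor_vimage_sets [measurable]: "vfloor -` {k} \<in> sets borel"
  using measurable_sets[OF vfloor_measurable, of "{k}"] by simp

text \<open>The image of \<open>P\<close> under \<open>vfloor\<close> is discrete, so its entropy is
  the mean of \<open>- ln\<close> of the probability of the cell containing the source. In this form
  it can be compared with other integrals over \<open>P\<close>.\<close>

lemma floor_entropy_eq:
  fixes f :: "real^'n \<Rightarrow> real"
  assumes [measurable]: "f \<in> borel_measurable borel" and f1: "(\<integral>\<^sup>+x. ennreal (f x) \<partial>lborel) = 1"
  defines "P \<equiv> density lborel (\<lambda>x. ennreal (f x))"
  shows "floor_entropy f = (\<integral>\<^sup>+x. ennreal (- ln (measure P (vfloor -` {vfloor x}))) \<partial>P)"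
proof -
  interpret prob_space P
    using f1 by (auto intro!: prob_spaceI simp: emeasure_density P_def)
  have [measurable_cong]: "sets P = sets borel" and [simp]: "space P = UNIV" by (simp_all add: P_def)
  define p where "p k = measure P (vfloor -` {k})" for k :: "int^'n"
  have "distr P (count_space UNIV) vfloor = density (count_space UNIV) (\<lambda>k. ennreal (p k))"
  proof (rule measure_eqI_countable[OF _ _ countable_UNIV_int_vec])
    fix k :: "int^'n"
    have "emeasure (distr P (count_space UNIV) vfloor) {k} = ennreal (p k)"
      by (subst emeasure_distr) (auto simp: p_def emeasure_eq_measure)
    then show "emeasure (distr P (count_space UNIV) vfloor) {k} = emeasure (density (count_space UNIV) (\<lambda>k. ennreal (p k))) {k}"
      by (simp add: emeasure_density nn_integral_count_space_indicator[symmetric])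
  qed auto
  moreover have "(\<integral>\<^sup>+x. ennreal (- ln (p (vfloor x))) \<partial>P) = (\<integral>\<^sup>+k. ennreal (- ln (p k)) \<partial>distr P (count_space UNIV) vfloor)"
    by (subst nn_integral_distr) auto
  ultimately have "(\<integral>\<^sup>+x. ennreal (- ln (p (vfloor x))) \<partial>P) = (\<integral>\<^sup>+k. ennreal (p k) * ennreal (- ln (p k)) \<partial>count_space UNIV)"
    by (simp add: nn_integral_density)
  also have "\<dots> = (\<integral>\<^sup>+k. ennreal (- p k * ln (p k)) \<partial>count_space UNIV)"
    by (intro nn_integral_cong) (simp add: p_def ennreal_mult'[symmetric])
  finally show ?thesis by (simp add: floor_entropy_def P_def p_def Let_def)
qed

text \<open>Coordinates differ by at most 1, and the Euclidean norm is at most the sum of their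
  absolute values. A crude diameter suffices, since it only enters constants.\<close>

lemma vfloor_eq_imp_norm_le:
  fixes x y :: "real^'n"
  assumes "vfloor x = vfloor y"
  shows "norm (x - y) \<le> CARD('n)"
proof -
  have "\<bar>(x - y) $ i\<bar> \<le> 1" for i
  proof -
    have "\<lfloor>x $ i\<rfloor> = \<lfloor>y $ i\<rfloor>" using assms by (simp add: vfloor_def vec_eq_iff)
    then show ?thesis by simp linarith
  qed
  then have "(\<Sum>i\<in>UNIV. \<bar>(x - y) $ i\<bar>) \<le> (\<Sum>i\<in>(UNIV::'n set). 1)" by (intro sum_mono)
  then show ?thesis using norm_le_l1_cart[of "x - y"] by simp
qed

lemma emeasure_vfloor_cell_ge: "1 \<le> emeasure lborel (vfloor -` {k :: int^'n})"
proof -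
  define a :: "real^'n" where "a = (\<chi> i. of_int (k $ i))"
  define b :: "real^'n" where "b = (\<chi> i. of_int (k $ i) + 1)"
  have "box a b \<subseteq> vfloor -` {k}"
    by (auto simp: a_def b_def vfloor_def vec_eq_iff mem_box_cart floor_eq_iff) (metis less_imp_le)
  then have "emeasure lborel (box a b) \<le> emeasure lborel (vfloor -` {k})"
    by (intro emeasure_mono) auto
  moreover have "emeasure lborel (box a b) = 1"
  proof -
    have "(b - a) \<bullet> i = 1" "a \<bullet> i \<le> b \<bullet> i" if "i \<in> Basis" for i
      using that by (auto simp: Basis_vec_def a_def b_def inner_axis inner_diff_left)
    then show ?thesis by (simp add: emeasure_lborel_box_eq)
  qed
  ultimately show ?thesis by simp
qed

text \<open>Applied to the truncated cell information \<open>s n\<close>,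
  \<open>mutual_info_ge\<close> has a constant \<open>ln A\<close> independent of \<open>n\<close>.
  A channel of finite mutual information would bound the integrals of all \<open>s n\<close>, and
  monotone convergence would make the floor entropy finite.\<close>

lemma rate_distortion_infinite:
  fixes f N :: "real^'n \<Rightarrow> real"
  assumes N: "is_norm N" and r: "r > 0" and [measurable]: "f \<in> borel_measurable borel"
    and f0: "\<And>x. f x \<ge> 0" and f1: "(\<integral>\<^sup>+x. ennreal (f x) \<partial>lborel) = 1"
    and H: "floor_entropy f = \<infinity>" and D: "D > 0"
  shows "rate_distortion f N r D = \<infinity>"
proof -
  note [measurable] = is_norm_measurable[OF N]
  define P where "P = density lborel (\<lambda>x. ennreal (f x))"
  have Ps [measurable_cong]: "sets P = sets borel" and [simp]: "space P = UNIV" by (simp_all add: P_def)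
  interpret P: prob_space P
    using f1 by (auto intro!: prob_spaceI simp: emeasure_density P_def)
  define p where "p x = measure P (vfloor -` {vfloor x})" for x :: "real^'n"
  have [measurable]: "p \<in> borel_measurable borel"
  proof -
    have "(\<lambda>x. (\<lambda>k. measure P (vfloor -` {k})) (vfloor x)) \<in> borel_measurable borel"
      by measurable
    then show ?thesis by (simp add: p_def[abs_def])
  qed
  have p: "0 \<le> p x" "p x \<le> 1" "ln (p x) \<le> 0" for x
  proof -
    show "0 \<le> p x" "p x \<le> 1" by (simp_all add: p_def)
    then show "ln (p x) \<le> 0" by (cases "p x = 0") auto
  qed
  \<comment> \<open>Truncation at \<open>n\<close> makes the test function bounded, hence
    integrable.\<close>
  define s where "s n x = min (- ln (p x)) (real n)" for n x
  have s: "0 \<le> s n x" "s n x \<le> n" for n x using p(3)[of x] by (auto simp: s_def)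
  have [measurable]: "s n \<in> borel_measurable borel" for n unfolding s_def by measurable
  have s_int: "integrable P (s n)" for n
    by (rule P.integrable_const_bound[where B = n]) (use s in \<open>auto simp: abs_of_nonneg\<close>)
  obtain B where B: "B > 0" "\<And>x. N x \<le> B * norm x" using is_norm_le_norm[OF N] by blast
  define b where "b = B * CARD('n)"
  have b0: "b > 0" using B by (simp add: b_def)
  have b: "N (x' - x) \<le> b" if "vfloor x = vfloor x'" for x x' :: "real^'n"
    using vfloor_eq_imp_norm_le[of x' x] that B(1) B(2)[of "x' - x"]
    unfolding b_def by (metis mult_left_mono less_imp_le order_trans)
  \<comment> \<open>Moves \<open>x\<close> to another point \<open>x'\<close> of its cell:
    \<open>N (x' - y)\<close> is at most twice the larger of \<open>N (x - y)\<close> and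
    \<open>b\<close>, which treats all \<open>r > 0\<close> at once. The price is the factor
    \<open>exp (b powr r)\<close> and the scale 2.\<close>
  have half: "exp (- (N (x - y) powr r)) \<le> exp (b powr r) * exp (- (2 powr (- r) * N (x' - y) powr r))"
    if "vfloor x = vfloor x'" for x x' y :: "real^'n"
  proof -
    have "N (x' - y) \<le> 2 * max (N (x - y)) b"
      using is_normD(4)[OF N, of "x' - x" "x - y"] b[OF that] by auto
    then have "N (x' - y) powr r \<le> (2 * max (N (x - y)) b) powr r"
      using r is_normD(1)[OF N] by (intro powr_mono2) auto
    also have "\<dots> = 2 powr r * max (N (x - y) powr r) (b powr r)"
      using r b0 is_normD(1)[OF N] by (simp add: powr_mult max_def powr_mono2 powr_less_mono2 not_le antisym)
    also have "\<dots> \<le> 2 powr r * (N (x - y) powr r + b powr r)"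
      by (intro mult_left_mono) auto
    finally have "2 powr (- r) * N (x' - y) powr r \<le> N (x - y) powr r + b powr r"
      by (simp add: powr_minus field_simps)
    then show ?thesis by (simp add: exp_add[symmetric])
  qed
  \<comment> \<open>\<open>s n\<close> is constant on a cell, and \<open>exp (s n x')\<close> is at
    most \<open>1 / p x'\<close> when \<open>p x' > 0\<close>, so each cell carries tilted mass at
    most 1. A cell of probability 0 contributes nothing.\<close>
  have cell: "(\<integral>\<^sup>+x. ennreal (f x * exp (s n x)) * indicator (vfloor -` {vfloor x'}) x \<partial>lborel) \<le> 1" for n x'
  proof -
    have "(\<integral>\<^sup>+x. ennreal (f x * exp (s n x)) * indicator (vfloor -` {vfloor x'}) x \<partial>lborel)
       = (\<integral>\<^sup>+x. ennreal (exp (s n x')) * (ennreal (f x) * indicator (vfloor -` {vfloor x'}) x) \<partial>lborel)"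
      using f0 by (intro nn_integral_cong) (auto simp: indicator_def s_def p_def ennreal_mult mult.commute)
    also have "\<dots> = ennreal (exp (s n x')) * emeasure P (vfloor -` {vfloor x'})"
      unfolding P_def by (simp add: nn_integral_cmult emeasure_density)
    also have "\<dots> = ennreal (exp (s n x') * p x')"
      by (simp add: p_def P.emeasure_eq_measure ennreal_mult)
    also have "\<dots> \<le> 1"
    proof (cases "p x' = 0")
      case False
      then have px: "p x' > 0" using p(1)[of x'] by simp
      have "exp (s n x') \<le> exp (- ln (p x'))" by (simp add: s_def)
      also have "\<dots> = 1 / p x'" using px by (simp add: exp_minus field_simps)
      finally have "exp (s n x') * p x' \<le> 1" using px by (simp add: field_simps)
      then show ?thesis by simp
    qed simp
    finally show ?thesis .
  qed
  \<comment> \<open>The factor \<open>2 ^ CARD('n) * norm_mass N r\<close> is the integral of the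
    right-hand exponential in \<open>half\<close>, by \<open>nn_integral_exp_norm_scaled\<close> at
    \<open>t = 2\<close>.\<close>
  define A where "A = exp (b powr r) * (2 ^ CARD('n) * (norm_mass N r))"
  have A: "A > 0" using norm_mass_pos[OF N r] by (simp add: A_def)
  \<comment> \<open>Averaging over the cell of \<open>x\<close> trades the integral against \<open>P\<close> for one against Lebesgue measure.\<close>
  have bound: "(\<integral>\<^sup>+x. ennreal (exp (s n x - 1 * N (x - y) powr r)) \<partial>P) \<le> ennreal (exp (ln A))" for n y
  proof -
    let ?I = "\<lambda>(x :: real^'n) x'. indicator (vfloor -` {vfloor x'}) x :: ennreal"
    have I: "?I x x' = ?I x' x" for x x' :: "real^'n" by (auto simp: indicator_def)
    have [measurable]: "(\<lambda>z. ?I (fst z) (snd z)) \<in> borel_measurable (borel \<Otimes>\<^sub>M borel)"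
    proof -
      have "{z. vfloor (fst z) = vfloor (snd z)} = (\<Union>k :: int^'n. (vfloor -` {k}) \<times> (vfloor -` {k}))" by auto
      also have "\<dots> \<in> sets (borel \<Otimes>\<^sub>M borel)"
        by (intro sets.countable_UN'' countable_UNIV_int_vec pair_measureI) auto
      finally have "(indicator {z. vfloor (fst z) = vfloor (snd z)} :: (real^'n) \<times> (real^'n) \<Rightarrow> ennreal)
          \<in> borel_measurable (borel \<Otimes>\<^sub>M borel)" by simp
      also have "indicator {z. vfloor (fst z) = vfloor (snd z)} = (\<lambda>z. ?I (fst z) (snd z))"
        by (auto simp: fun_eq_iff indicator_def)
      finally show ?thesis .
    qed
    have [measurable]: "(\<lambda>z. ?I (snd z) (fst z)) \<in> borel_measurable (borel \<Otimes>\<^sub>M borel)"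
      by (subst I) measurable
    have "(\<integral>\<^sup>+x. ennreal (exp (s n x - 1 * N (x - y) powr r)) \<partial>P)
        = (\<integral>\<^sup>+x. ennreal (f x * exp (s n x)) * ennreal (exp (- (N (x - y) powr r))) \<partial>lborel)"
      unfolding P_def using f0
      by (subst nn_integral_density) (auto intro!: nn_integral_cong simp: ennreal_mult[symmetric] exp_diff exp_minus field_simps)
    also have "\<dots> \<le> (\<integral>\<^sup>+x. ennreal (f x * exp (s n x)) * ennreal (exp (- (N (x - y) powr r))) * (\<integral>\<^sup>+x'. ?I x' x \<partial>lborel) \<partial>lborel)"
    proof (intro nn_integral_mono)
      fix x
      have "1 \<le> (\<integral>\<^sup>+x'. ?I x' x \<partial>lborel)" using emeasure_vfloor_cell_ge[of "vfloor x"] by simp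
      then show "ennreal (f x * exp (s n x)) * ennreal (exp (- (N (x - y) powr r)))
          \<le> ennreal (f x * exp (s n x)) * ennreal (exp (- (N (x - y) powr r))) * (\<integral>\<^sup>+x'. ?I x' x \<partial>lborel)"
        by (metis mult.right_neutral mult_left_mono zero_le)
    qed
    also have "\<dots> = (\<integral>\<^sup>+x. (\<integral>\<^sup>+x'. ennreal (f x * exp (s n x)) * ennreal (exp (- (N (x - y) powr r))) * ?I x' x \<partial>lborel) \<partial>lborel)"
      by (intro nn_integral_cong nn_integral_cmult[symmetric]) simp
    also have "\<dots> \<le> (\<integral>\<^sup>+x. (\<integral>\<^sup>+x'. ennreal (f x * exp (s n x)) *
         ennreal (exp (b powr r) * exp (- (2 powr (- r) * N (x' - y) powr r))) * ?I x x' \<partial>lborel) \<partial>lborel)"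
    proof (intro nn_integral_mono)
      fix x x'
      show "ennreal (f x * exp (s n x)) * ennreal (exp (- (N (x - y) powr r))) * ?I x' x \<le>
        ennreal (f x * exp (s n x)) * ennreal (exp (b powr r) * exp (- (2 powr (- r) * N (x' - y) powr r))) * ?I x x'"
      proof (cases "vfloor x = vfloor x'")
        case True
        then show ?thesis by (auto intro!: mult_left_mono ennreal_leI half)
      qed auto
    qed
    also have "\<dots> = (\<integral>\<^sup>+x'. (\<integral>\<^sup>+x. ennreal (f x * exp (s n x)) *
         ennreal (exp (b powr r) * exp (- (2 powr (- r) * N (x' - y) powr r))) * ?I x x' \<partial>lborel) \<partial>lborel)"
      by (rule lborel_pair.Fubini') measurable
    also have "\<dots> = (\<integral>\<^sup>+x'. ennreal (exp (b powr r) * exp (- (2 powr (- r) * N (x' - y) powr r))) *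
        (\<integral>\<^sup>+x. ennreal (f x * exp (s n x)) * ?I x x' \<partial>lborel) \<partial>lborel)"
      by (subst nn_integral_cmult[symmetric]) (auto intro!: nn_integral_cong simp: mult_ac)
    also have "\<dots> \<le> (\<integral>\<^sup>+x'. ennreal (exp (b powr r) * exp (- (2 powr (- r) * N (x' - y) powr r))) * 1 \<partial>lborel)"
      by (intro nn_integral_mono mult_left_mono cell) simp
    also have "\<dots> = ennreal (exp (b powr r)) * (\<integral>\<^sup>+x'. ennreal (exp (- (2 powr (- r) * N (x' - y) powr r))) \<partial>lborel)"
      by (subst nn_integral_cmult[symmetric]) (auto simp: ennreal_mult)
    also have "\<dots> = ennreal (exp (ln A))"
      using nn_integral_exp_norm_scaled[OF N r, of 2 y] A by (simp add: A_def ennreal_mult')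
    finally show ?thesis .
  qed
  have "mutual_info (joint_dist P K) = \<infinity>"
    if K: "K \<in> borel \<rightarrow>\<^sub>M prob_algebra borel"
      and dist: "(\<integral>\<^sup>+z. ennreal (N (fst z - snd z) powr r) \<partial>joint_dist P K) \<le> ennreal D" for K
  proof (rule ccontr)
    let ?I = "mutual_info (joint_dist P K)"
    assume fin: "?I \<noteq> \<infinity>"
    have ge: "ereal ((\<integral>x. s n x \<partial>P) - ln A - 1 * D) \<le> ?I" for n
      by (rule mutual_info_ge[OF P.prob_space_axioms Ps K N s_int _ _ dist bound]) (use D in auto)
    then have "?I \<noteq> -\<infinity>" using ge[of 0] by auto
    with fin obtain i where i: "?I = ereal i" by (cases ?I) auto
    have le: "(\<integral>\<^sup>+x. ennreal (s n x) \<partial>P) \<le> ennreal (i + ln A + D)" for n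
    proof -
      have "(\<integral>\<^sup>+x. ennreal (s n x) \<partial>P) = ennreal (\<integral>x. s n x \<partial>P)"
        using s s_int by (intro nn_integral_eq_integral) auto
      also have "\<dots> \<le> ennreal (i + ln A + D)" using ge[of n] i by (intro ennreal_leI) simp
      finally show ?thesis .
    qed
    have sup: "(SUP n. ennreal (s n x)) = ennreal (- ln (p x))" for x
    proof (rule antisym)
      show "(SUP n. ennreal (s n x)) \<le> ennreal (- ln (p x))"
        by (intro SUP_least ennreal_leI) (simp add: s_def)
      obtain n :: nat where "- ln (p x) \<le> n" using real_arch_simple by blast
      then have "s n x = - ln (p x)" by (simp add: s_def)
      then show "ennreal (- ln (p x)) \<le> (SUP n. ennreal (s n x))" by (metis SUP_upper UNIV_I)
    qed
    have "floor_entropy f = (\<integral>\<^sup>+x. (SUP n. ennreal (s n x)) \<partial>P)"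
      unfolding sup using floor_entropy_eq[OF _ f1] by (simp add: p_def P_def)
    also have "\<dots> = (SUP n. (\<integral>\<^sup>+x. ennreal (s n x) \<partial>P))"
      by (intro nn_integral_monotone_convergence_SUP)
        (auto simp: incseq_def le_fun_def s_def intro!: ennreal_leI)
    also have "\<dots> \<le> ennreal (i + ln A + D)" by (intro SUP_least le)
    finally show False using H by (simp add: top_unique)
  qed
  then show ?thesis
    unfolding rate_distortion_def P_def[symmetric] by (intro antisym INF_greatest) auto
qed

section \<open>Additive noise channels\<close>

lemma distr_pair_snd:
  assumes "prob_space M" "sigma_finite_measure N"
  shows "distr (M \<Otimes>\<^sub>M N) N snd = N"
proof (rule measure_eqI)
  interpret M: prob_space M by fact
  interpret N: sigma_finite_measure N by fact
  fix A assume A: "A \<in> sets (distr (M \<Otimes>\<^sub>M N) N snd)"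
  then have "emeasure (distr (M \<Otimes>\<^sub>M N) N snd) A = emeasure (M \<Otimes>\<^sub>M N) (space M \<times> A)"
    by (auto simp: emeasure_distr space_pair_measure dest: sets.sets_into_space intro!: arg_cong2[where f = emeasure])
  then show "emeasure (distr (M \<Otimes>\<^sub>M N) N snd) A = emeasure N A"
    using A by (simp add: N.emeasure_pair_measure_Times M.emeasure_space_1)
qed simp

text \<open>Used for output and smoothed densities: it makes them genuine positive reals, so
  \<open>enn2real\<close> loses nothing and logarithms can be taken. A vanishing integral would
  force \<open>f = 0\<close> almost everywhere, against total mass 1.\<close>

lemma nn_integral_prob_density_mult:
  fixes f k :: "'a \<Rightarrow> real"
  assumes [measurable]: "f \<in> borel_measurable M" "k \<in> borel_measurable M"
    and f0: "\<And>x. f x \<ge> 0" and f1: "(\<integral>\<^sup>+x. ennreal (f x) \<partial>M) = 1"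
    and k0: "\<And>x. k x > 0" and k_le: "\<And>x. k x \<le> C"
  shows "0 < (\<integral>\<^sup>+x. ennreal (f x * k x) \<partial>M)" "(\<integral>\<^sup>+x. ennreal (f x * k x) \<partial>M) \<le> ennreal C"
proof -
  have "C \<ge> 0" using k0[of undefined] k_le[of undefined] by simp
  have "(\<integral>\<^sup>+x. ennreal (f x * k x) \<partial>M) \<le> (\<integral>\<^sup>+x. ennreal C * ennreal (f x) \<partial>M)"
    using f0 k_le \<open>C \<ge> 0\<close> by (intro nn_integral_mono)
      (simp add: ennreal_mult[symmetric] mult.commute[of C] ennreal_leI mult_left_mono)
  then show "(\<integral>\<^sup>+x. ennreal (f x * k x) \<partial>M) \<le> ennreal C" by (simp add: nn_integral_cmult f1)
  have "(\<integral>\<^sup>+x. ennreal (f x * k x) \<partial>M) \<noteq> 0"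
  proof
    assume "(\<integral>\<^sup>+x. ennreal (f x * k x) \<partial>M) = 0"
    then have "AE x in M. ennreal (f x * k x) = 0"
      by (subst (asm) nn_integral_0_iff_AE) auto
    then have "AE x in M. ennreal (f x) = 0"
    proof eventually_elim
      case (elim x)
      then show ?case using f0[of x] k0[of x] by (simp add: ennreal_eq_0_iff mult_le_0_iff)
    qed
    then have "(\<integral>\<^sup>+x. ennreal (f x) \<partial>M) = 0" by (subst nn_integral_0_iff_AE) auto
    then show False using f1 by simp
  qed
  then show "0 < (\<integral>\<^sup>+x. ennreal (f x * k x) \<partial>M)" by (simp add: zero_less_iff_neq_zero)
qed

text \<open>With \<open>m\<close> the output density, the mutual information is the mean of
  \<open>ln (k (y - x)) - ln (m y)\<close>. Replacing \<open>m\<close> by a reference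
  \<open>q\<close> costs the mean of \<open>ln (q y / m y)\<close>, at most the integral of
  \<open>q\<close> minus 1 by \<open>ln v \<le> v - 1\<close>. Bounds on \<open>q\<close> thus take
  the place of any control of \<open>ln m\<close>.\<close>

lemma mutual_info_additive_noise_le:
  fixes f k q :: "'a::euclidean_space \<Rightarrow> real"
  assumes [measurable]: "f \<in> borel_measurable borel" "k \<in> borel_measurable borel" "q \<in> borel_measurable borel"
    and f0: "\<And>x. f x \<ge> 0" and f1: "(\<integral>\<^sup>+x. ennreal (f x) \<partial>lborel) = 1"
    and k0: "\<And>x. k x > 0" and k_le: "\<And>x. k x \<le> C" and k1: "(\<integral>\<^sup>+x. ennreal (k x) \<partial>lborel) = 1"
    and q0: "\<And>x. q x > 0" and q1: "(\<integral>\<^sup>+x. ennreal (q x) \<partial>lborel) \<le> ennreal c" and c0: "c \<ge> 0"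
  defines "P \<equiv> density lborel (\<lambda>x. ennreal (f x))" and "\<nu> \<equiv> density lborel (\<lambda>x. ennreal (k x))"
  defines "K \<equiv> \<lambda>x. distr \<nu> borel (\<lambda>z. x + z)"
  assumes int_k: "integrable \<nu> (\<lambda>z. ln (k z))"
    and int_q: "integrable (P \<Otimes>\<^sub>M \<nu>) (\<lambda>(x, z). ln (q (x + z)))"
  shows "K \<in> borel \<rightarrow>\<^sub>M prob_algebra borel"
    and "joint_dist P K = distr (P \<Otimes>\<^sub>M \<nu>) (borel \<Otimes>\<^sub>M borel) (\<lambda>(x, z). (x, x + z))"
    and "mutual_info (joint_dist P K) \<le> ereal ((\<integral>z. ln (k z) \<partial>\<nu>) - (\<integral>(x, z). ln (q (x + z)) \<partial>(P \<Otimes>\<^sub>M \<nu>)) + c - 1)"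
proof -
  let ?J = "joint_dist P K" and ?T = "\<lambda>(x, z). (x, x + z) :: 'a \<times> 'a"
  have [measurable_cong]: "sets P = sets borel" "sets \<nu> = sets borel" by (simp_all add: P_def \<nu>_def)
  interpret P: prob_space P
    using f1 by (auto intro!: prob_spaceI simp: emeasure_density P_def)
  interpret \<nu>: prob_space \<nu>
    using k1 by (auto intro!: prob_spaceI simp: emeasure_density \<nu>_def)
  interpret P\<nu>: pair_prob_space P \<nu> ..
  show K: "K \<in> borel \<rightarrow>\<^sub>M prob_algebra borel"
  proof (rule measurable_prob_algebraI)
    show "prob_space (K x)" for x unfolding K_def by (rule \<nu>.prob_space_distr) simp
    show "K \<in> borel \<rightarrow>\<^sub>M subprob_algebra borel"
      unfolding K_def
    proof (rule measurable_distr2[where M = borel])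
      show "(\<lambda>x. \<nu>) \<in> borel \<rightarrow>\<^sub>M subprob_algebra borel"
        using \<nu>.prob_space_axioms prob_space_imp_subprob_space
        by (intro measurable_const) (auto simp: space_subprob_algebra \<nu>_def)
    qed simp
  qed
  have Ps: "sets P = sets borel" by (simp add: P_def)
  note J = sets_joint_dist[OF P.prob_space_axioms Ps K] nn_integral_joint_dist[OF P.prob_space_axioms Ps K]
  note [measurable_cong] = J(1)
  interpret J: prob_space ?J by (rule prob_space_joint_dist[OF P.prob_space_axioms Ps K])
  have JT: "(\<integral>\<^sup>+z. g z \<partial>?J) = (\<integral>\<^sup>+z. g (?T z) \<partial>(P \<Otimes>\<^sub>M \<nu>))"
    if [measurable]: "g \<in> borel_measurable (borel \<Otimes>\<^sub>M borel)" for g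
  proof -
    have "(\<integral>\<^sup>+y. g (x, y) \<partial>K x) = (\<integral>\<^sup>+z. g (x, x + z) \<partial>\<nu>)" for x
      unfolding K_def by (intro nn_integral_distr) auto
    then have "(\<integral>\<^sup>+z. g z \<partial>?J) = (\<integral>\<^sup>+x. (\<integral>\<^sup>+z. g (x, x + z) \<partial>\<nu>) \<partial>P)"
      by (simp add: J(2)[OF that])
    also have "\<dots> = (\<integral>\<^sup>+z. g (?T z) \<partial>(P \<Otimes>\<^sub>M \<nu>))"
      by (subst \<nu>.nn_integral_fst[symmetric]) auto
    finally show ?thesis .
  qed
  show J_distr: "?J = distr (P \<Otimes>\<^sub>M \<nu>) (borel \<Otimes>\<^sub>M borel) ?T"
  proof (rule measure_eqI)
    fix A assume "A \<in> sets ?J"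
    then have [measurable]: "A \<in> sets (borel \<Otimes>\<^sub>M borel)" by (simp add: J)
    have "emeasure ?J A = (\<integral>\<^sup>+z. indicator A z \<partial>?J)" by simp
    also have "\<dots> = (\<integral>\<^sup>+z. indicator A (?T z) \<partial>(P \<Otimes>\<^sub>M \<nu>))" by (rule JT) simp
    also have "\<dots> = (\<integral>\<^sup>+z. indicator A z \<partial>distr (P \<Otimes>\<^sub>M \<nu>) (borel \<Otimes>\<^sub>M borel) ?T)"
      by (rule nn_integral_distr[symmetric]) auto
    also have "\<dots> = emeasure (distr (P \<Otimes>\<^sub>M \<nu>) (borel \<Otimes>\<^sub>M borel) ?T) A" by simp
    finally show "emeasure ?J A = emeasure (distr (P \<Otimes>\<^sub>M \<nu>) (borel \<Otimes>\<^sub>M borel) ?T) A" .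
  qed (simp add: J)
  have J_lborel: "(\<integral>\<^sup>+z. g z \<partial>?J) = (\<integral>\<^sup>+x. (\<integral>\<^sup>+y. ennreal (f x * k (y - x)) * g (x, y) \<partial>lborel) \<partial>lborel)"
    if [measurable]: "g \<in> borel_measurable (borel \<Otimes>\<^sub>M borel)" for g
  proof -
    have "(\<integral>\<^sup>+z. g z \<partial>?J) = (\<integral>\<^sup>+x. ennreal (f x) * (\<integral>\<^sup>+z. ennreal (k z) * g (x, x + z) \<partial>lborel) \<partial>lborel)"
    proof -
      have "(\<integral>\<^sup>+y. g (x, y) \<partial>K x) = (\<integral>\<^sup>+z. ennreal (k z) * g (x, x + z) \<partial>lborel)" for x
        unfolding K_def \<nu>_def by (subst nn_integral_distr) (auto simp: nn_integral_density)
      then have "(\<integral>\<^sup>+z. g z \<partial>?J) = (\<integral>\<^sup>+x. (\<integral>\<^sup>+z. ennreal (k z) * g (x, x + z) \<partial>lborel) \<partial>P)"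
        by (simp add: J(2)[OF that])
      then show ?thesis by (simp add: P_def nn_integral_density)
    qed
    also have "\<dots> = (\<integral>\<^sup>+x. ennreal (f x) * (\<integral>\<^sup>+y. ennreal (k (y - x)) * g (x, y) \<partial>lborel) \<partial>lborel)"
    proof -
      have "(\<integral>\<^sup>+z. ennreal (k z) * g (x, x + z) \<partial>lborel) = (\<integral>\<^sup>+y. ennreal (k (y - x)) * g (x, y) \<partial>lborel)" for x
        by (subst (2) nn_integral_lborel_affine[of _ 1 x]) auto
      then show ?thesis by simp
    qed
    also have "\<dots> = (\<integral>\<^sup>+x. (\<integral>\<^sup>+y. ennreal (f x * k (y - x)) * g (x, y) \<partial>lborel) \<partial>lborel)"
      using f0 k0 by (subst nn_integral_cmult[symmetric])
        (auto intro!: nn_integral_cong simp: ennreal_mult mult_ac less_imp_le)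
    finally show ?thesis .
  qed
  \<comment> \<open>The density of the output; boundedness of \<open>k\<close> keeps it finite
    everywhere.\<close>
  define m where "m y = enn2real (\<integral>\<^sup>+x. ennreal (f x * k (y - x)) \<partial>lborel)" for y
  have [measurable]: "m \<in> borel_measurable borel" unfolding m_def by measurable
  have m_pos: "m y > 0" and m_eq: "ennreal (m y) = (\<integral>\<^sup>+x. ennreal (f x * k (y - x)) \<partial>lborel)" for y
  proof -
    have "0 < (\<integral>\<^sup>+x. ennreal (f x * k (y - x)) \<partial>lborel)" "(\<integral>\<^sup>+x. ennreal (f x * k (y - x)) \<partial>lborel) \<le> ennreal C"
      using nn_integral_prob_density_mult[of f lborel "\<lambda>x. k (y - x)" C] f0 f1 k0 k_le by simp_all
    then show "m y > 0" "ennreal (m y) = (\<integral>\<^sup>+x. ennreal (f x * k (y - x)) \<partial>lborel)"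
      unfolding m_def by (auto simp: enn2real_positive_iff order_le_less_trans)
  qed
  have J_snd: "(\<integral>\<^sup>+z. g (snd z) \<partial>?J) = (\<integral>\<^sup>+y. ennreal (m y) * g y \<partial>lborel)"
    if [measurable]: "g \<in> borel_measurable borel" for g
  proof -
    have "(\<integral>\<^sup>+z. g (snd z) \<partial>?J) = (\<integral>\<^sup>+x. (\<integral>\<^sup>+y. ennreal (f x * k (y - x)) * g y \<partial>lborel) \<partial>lborel)"
      by (subst J_lborel) auto
    also have "\<dots> = (\<integral>\<^sup>+y. (\<integral>\<^sup>+x. ennreal (f x * k (y - x)) * g y \<partial>lborel) \<partial>lborel)"
      by (rule lborel_pair.Fubini'[symmetric]) measurable
    also have "\<dots> = (\<integral>\<^sup>+y. ennreal (m y) * g y \<partial>lborel)"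
      by (simp add: m_eq nn_integral_multc)
    finally show ?thesis .
  qed
  define Q where "Q = density lborel (\<lambda>y. ennreal (m y))"
  have [measurable_cong]: "sets Q = sets borel" by (simp add: Q_def)
  have Q: "distr ?J borel snd = Q"
  proof (rule measure_eqI)
    fix A assume "A \<in> sets (distr ?J borel snd)"
    then have [measurable]: "A \<in> sets borel" by simp
    have "emeasure (distr ?J borel snd) A = (\<integral>\<^sup>+z. indicator A z \<partial>distr ?J borel snd)" by simp
    also have "\<dots> = (\<integral>\<^sup>+z. indicator A (snd z) \<partial>?J)" by (rule nn_integral_distr) auto
    also have "\<dots> = (\<integral>\<^sup>+y. ennreal (m y) * indicator A y \<partial>lborel)" by (rule J_snd) simp
    also have "\<dots> = emeasure Q A" by (simp add: Q_def emeasure_density)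
    finally show "emeasure (distr ?J borel snd) A = emeasure Q A" .
  qed (simp add: Q_def)
  interpret Q: prob_space Q unfolding Q[symmetric] by (rule J.prob_space_distr) simp
  interpret PQ: pair_prob_space P Q ..
  \<comment> \<open>The joint density \<open>f x * k (y - x)\<close> divided by the product
    \<open>f x * m y\<close> of the marginal densities.\<close>
  define g where "g z = k (snd z - fst z) / m (snd z)" for z
  have [measurable]: "g \<in> borel_measurable (borel \<Otimes>\<^sub>M borel)" unfolding g_def by measurable
  have g0: "g z > 0" for z using k0 m_pos by (simp add: g_def)
  have Jg: "?J = density (P \<Otimes>\<^sub>M Q) (\<lambda>z. ennreal (g z))"
  proof (rule measure_eqI)
    fix A assume "A \<in> sets ?J"
    then have [measurable]: "A \<in> sets (borel \<Otimes>\<^sub>M borel)" by (simp add: J)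
    have "emeasure (density (P \<Otimes>\<^sub>M Q) (\<lambda>z. ennreal (g z))) A = (\<integral>\<^sup>+z. ennreal (g z) * indicator A z \<partial>(P \<Otimes>\<^sub>M Q))"
      by (rule emeasure_density) auto
    also have "\<dots> = (\<integral>\<^sup>+x. (\<integral>\<^sup>+y. ennreal (g (x, y)) * indicator A (x, y) \<partial>Q) \<partial>P)"
      by (subst Q.nn_integral_fst[symmetric]) auto
    also have "\<dots> = (\<integral>\<^sup>+x. ennreal (f x) * (\<integral>\<^sup>+y. ennreal (m y) * (ennreal (g (x, y)) * indicator A (x, y)) \<partial>lborel) \<partial>lborel)"
      unfolding P_def Q_def by (simp add: nn_integral_density)
    also have "\<dots> = (\<integral>\<^sup>+x. (\<integral>\<^sup>+y. ennreal (f x * k (y - x)) * indicator A (x, y) \<partial>lborel) \<partial>lborel)"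
    proof (intro nn_integral_cong)
      fix x
      have "ennreal (m y) * (ennreal (g (x, y)) * indicator A (x, y)) = ennreal (k (y - x)) * indicator A (x, y)" for y
        using m_pos[of y] k0[of "y - x"] by (simp add: g_def mult.assoc[symmetric] ennreal_mult[symmetric])
      then show "ennreal (f x) * (\<integral>\<^sup>+y. ennreal (m y) * (ennreal (g (x, y)) * indicator A (x, y)) \<partial>lborel) =
         (\<integral>\<^sup>+y. ennreal (f x * k (y - x)) * indicator A (x, y) \<partial>lborel)"
        using f0 k0 by (subst nn_integral_cmult[symmetric])
          (auto intro!: nn_integral_cong simp: ennreal_mult mult_ac less_imp_le)
    qed
    also have "\<dots> = (\<integral>\<^sup>+z. indicator A z \<partial>?J)" by (rule J_lborel[symmetric]) simp
    also have "\<dots> = emeasure ?J A" by simp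
    finally show "emeasure ?J A = emeasure (density (P \<Otimes>\<^sub>M Q) (\<lambda>z. ennreal (g z))) A" ..
  next
    show "sets ?J = sets (density (P \<Otimes>\<^sub>M Q) (\<lambda>z. ennreal (g z)))"
      unfolding J(1) sets_density by (rule sets_pair_measure_cong) (simp_all add: P_def Q_def)
  qed
  \<comment> \<open>\<open>ln (g z)\<close> splits as
    \<open>b z + ln (q (snd z) / m (snd z))\<close>: \<open>b\<close> is integrable by
    \<open>int_k\<close> and \<open>int_q\<close>, and only the second term is estimated.\<close>
  define b where "b z = ln (k (snd z - fst z)) - ln (q (snd z))" for z
  have [measurable]: "b \<in> borel_measurable (borel \<Otimes>\<^sub>M borel)" unfolding b_def by measurable
  have int_k': "integrable (P \<Otimes>\<^sub>M \<nu>) (\<lambda>z. ln (k (snd z)))"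
    and "(\<integral>z. ln (k (snd z)) \<partial>(P \<Otimes>\<^sub>M \<nu>)) = (\<integral>z. ln (k z) \<partial>\<nu>)"
  proof -
    have *: "distr (P \<Otimes>\<^sub>M \<nu>) \<nu> snd = \<nu>" 
      by (rule distr_pair_snd[OF P.prob_space_axioms \<nu>.sigma_finite_measure_axioms])
    show "integrable (P \<Otimes>\<^sub>M \<nu>) (\<lambda>z. ln (k (snd z)))"
      using int_k by (subst (asm) *[symmetric], subst (asm) integrable_distr_eq) auto
    show "(\<integral>z. ln (k (snd z)) \<partial>(P \<Otimes>\<^sub>M \<nu>)) = (\<integral>z. ln (k z) \<partial>\<nu>)"
      by (subst (2) *[symmetric], subst integral_distr) auto
  qed
  moreover have bT: "b (?T z) = ln (k (snd z)) - (case z of (x, z) \<Rightarrow> ln (q (x + z)))" for z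
    by (simp add: b_def case_prod_unfold)
  moreover have "integrable ?J b \<longleftrightarrow> integrable (P \<Otimes>\<^sub>M \<nu>) (\<lambda>z. b (?T z))"
    "(\<integral>z. b z \<partial>?J) = (\<integral>z. b (?T z) \<partial>(P \<Otimes>\<^sub>M \<nu>))"
    unfolding J_distr by (subst integrable_distr_eq integral_distr; simp)+
  ultimately have int_b: "integrable ?J b"
    and b_eq: "(\<integral>z. b z \<partial>?J) = (\<integral>z. ln (k z) \<partial>\<nu>) - (\<integral>(x, z). ln (q (x + z)) \<partial>(P \<Otimes>\<^sub>M \<nu>))"
    using int_q unfolding bT by (simp_all add: Bochner_Integration.integral_diff)
  \<comment> \<open>The output has density \<open>m\<close>, so \<open>m\<close> cancels and the
    mean of the quotient is the integral of \<open>q\<close>.\<close>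
  have qm: "(\<integral>\<^sup>+z. ennreal (q (snd z) / m (snd z)) \<partial>?J) \<le> ennreal c"
  proof -
    have "(\<integral>\<^sup>+z. ennreal (q (snd z) / m (snd z)) \<partial>?J) = (\<integral>\<^sup>+y. ennreal (m y) * ennreal (q y / m y) \<partial>lborel)"
      by (rule J_snd) simp
    also have "\<dots> = (\<integral>\<^sup>+y. ennreal (q y) \<partial>lborel)"
      using m_pos q0 by (intro nn_integral_cong) (simp add: ennreal_mult''[symmetric] less_imp_le less_imp_neq[symmetric])
    finally show ?thesis using q1 by simp
  qed
  have int_qm: "integrable ?J (\<lambda>z. q (snd z) / m (snd z))"
    using qm m_pos q0 by (intro integrableI_nonneg) (auto simp: order_le_less_trans less_imp_le)
  have le: "ln (g z) \<le> b z + q (snd z) / m (snd z) - 1" for z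
  proof -
    have "ln (q (snd z) / m (snd z)) \<le> q (snd z) / m (snd z) - 1"
      using q0 m_pos by (intro ln_le_minus_one) simp
    moreover have "ln (g z) = b z + ln (q (snd z) / m (snd z))"
      using q0[of "snd z"] m_pos[of "snd z"] k0[of "snd z - fst z"] by (simp add: g_def b_def ln_div)
    ultimately show ?thesis by simp
  qed
  \<comment> \<open>The pointwise bound \<open>le\<close> controls the positive part, the general
    bound for densities the negative part.\<close>
  have int_g: "integrable ?J (\<lambda>z. ln (g z))"
    unfolding real_integrable_def
  proof (intro conjI)
    have "(\<integral>\<^sup>+z. ennreal (ln (g z)) \<partial>?J) \<le> (\<integral>\<^sup>+z. ennreal (norm (b z + q (snd z) / m (snd z))) \<partial>?J)"
      by (intro nn_integral_mono ennreal_leI) (use le in \<open>smt (verit) real_norm_def\<close>)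
    also have "\<dots> < \<infinity>"
      using Bochner_Integration.integrable_add[OF int_b int_qm] unfolding integrable_iff_bounded by simp
    finally show "(\<integral>\<^sup>+z. ennreal (ln (g z)) \<partial>?J) \<noteq> \<infinity>" by simp
    have "(\<integral>\<^sup>+z. ennreal (- ln (g z)) \<partial>?J) \<le> emeasure (P \<Otimes>\<^sub>M Q) (space (P \<Otimes>\<^sub>M Q))"
      by (rule nn_integral_neg_ln_density_le[OF _ _ Jg]) (use g0 in \<open>auto intro: less_imp_le\<close>)
    then show "(\<integral>\<^sup>+z. ennreal (- ln (g z)) \<partial>?J) \<noteq> \<infinity>"
      using PQ.emeasure_space_1 by (auto simp: top_unique)
  qed simp
  have "mutual_info ?J = KL_div ?J (P \<Otimes>\<^sub>M Q)"
    by (simp add: mutual_info_def Q distr_joint_dist_fst[OF P.prob_space_axioms Ps K])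
  also have "\<dots> = ereal (\<integral>z. ln (g z) \<partial>?J)"
    by (rule KL_div_density_integral[OF PQ.sigma_finite_measure_axioms _ _ Jg int_g])
      (use g0 in \<open>auto intro: less_imp_le\<close>)
  also have "(\<integral>z. ln (g z) \<partial>?J) \<le> (\<integral>z. b z + q (snd z) / m (snd z) - 1 \<partial>?J)"
    using int_g int_b int_qm le by (intro integral_mono) auto
  also have "\<dots> = (\<integral>z. b z \<partial>?J) + (\<integral>z. q (snd z) / m (snd z) \<partial>?J) - 1"
    using int_b int_qm by (simp add: J.prob_space)
  also have "(\<integral>z. q (snd z) / m (snd z) \<partial>?J) \<le> c"
  proof -
    have "ennreal (\<integral>z. q (snd z) / m (snd z) \<partial>?J) \<le> ennreal c"
      using qm q0 m_pos int_qm by (subst (asm) nn_integral_eq_integral) (auto simp: less_imp_le)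
    then show ?thesis using c0 by simp
  qed
  finally show "mutual_info ?J \<le> ereal ((\<integral>z. ln (k z) \<partial>\<nu>) - (\<integral>(x, z). ln (q (x + z)) \<partial>(P \<Otimes>\<^sub>M \<nu>)) + c - 1)"
    by (simp add: b_eq)
qed

section \<open>The scaled exponential noise as a test channel\<close>

definition noise :: "('a::euclidean_space \<Rightarrow> real) \<Rightarrow> real \<Rightarrow> 'a measure" where
  "noise N r = density lborel (\<lambda>z. ennreal (exp (- (N z powr r)) / norm_mass N r))"

lemma sets_noise [simp, measurable_cong]: "sets (noise N r) = sets borel"
  by (simp add: noise_def)

text \<open>The moment \<open>DIM('a) / r\<close> dictates the scale \<open>t\<close>, since scaling
  by \<open>t\<close> multiplies it by \<open>t powr r\<close>. Keeping \<open>noise\<close>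
  unscaled places all distortion levels on one probability space, where dominated convergence can be
  applied.\<close>

lemma
  fixes N :: "'a::euclidean_space \<Rightarrow> real"
  assumes N: "is_norm N" and r: "r > 0"
  shows prob_space_noise: "prob_space (noise N r)"
    and nn_integral_noise_norm: "(\<integral>\<^sup>+z. ennreal (N z powr r) \<partial>noise N r) = ennreal (DIM('a) / r)"
proof -
  note [measurable] = is_norm_measurable[OF N]
  have A: "norm_mass N r > 0" by (rule norm_mass_pos[OF N r])
  have "(\<integral>\<^sup>+z. ennreal (exp (- (N z powr r)) / norm_mass N r) \<partial>lborel) =
      (\<integral>\<^sup>+z. ennreal (exp (- (N z powr r))) \<partial>lborel) / ennreal (norm_mass N r)"
    using A by (subst nn_integral_divide[symmetric]) (auto simp: divide_ennreal)
  also have "\<dots> = 1" using A by (simp add: nn_integral_exp_norm[OF N r] divide_ennreal)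
  finally show "prob_space (noise N r)"
    by (auto intro!: prob_spaceI simp: noise_def emeasure_density)
  have "(\<integral>\<^sup>+z. ennreal (N z powr r) \<partial>noise N r) =
      (\<integral>\<^sup>+z. ennreal (N z powr r * exp (- (N z powr r))) / ennreal (norm_mass N r) \<partial>lborel)"
    using A unfolding noise_def
    by (subst nn_integral_density)
      (auto intro!: nn_integral_cong simp: divide_ennreal ennreal_mult[symmetric] mult.commute)
  also have "\<dots> = (\<integral>\<^sup>+z. ennreal (N z powr r * exp (- (N z powr r))) \<partial>lborel) / ennreal (norm_mass N r)"
    by (rule nn_integral_divide) measurable
  also have "\<dots> = ennreal (DIM('a) / r)"
    using A r by (simp add: nn_integral_norm_exp_norm[OF N r] divide_ennreal)
  finally show "(\<integral>\<^sup>+z. ennreal (N z powr r) \<partial>noise N r) = ennreal (DIM('a) / r)" .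
qed

text \<open>The noise \<open>t *\<^sub>R Z\<close>, with \<open>Z\<close> of law
  \<open>noise N r\<close>, meets the distortion constraint with equality. The mean of its log
  density is \<open>- (CARD('n) / r) - ln A\<close>, the terms of \<open>R_SLB_alt\<close>, so the
  bound differs from \<open>R_SLB\<close> only through \<open>q\<close>, \<open>c\<close> and the
  entropy of the source.\<close>

lemma rate_distortion_le:
  fixes f N q :: "real^'n \<Rightarrow> real"
  assumes N: "is_norm N" and r: "r > 0"
    and [measurable]: "f \<in> borel_measurable borel" "q \<in> borel_measurable borel"
    and f0: "\<And>x. f x \<ge> 0" and f1: "(\<integral>\<^sup>+x. ennreal (f x) \<partial>lborel) = 1"
    and q0: "\<And>x. q x > 0" and q1: "(\<integral>\<^sup>+x. ennreal (q x) \<partial>lborel) \<le> ennreal c" and c0: "c \<ge> 0" and D: "D > 0"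
  defines "P \<equiv> density lborel (\<lambda>x. ennreal (f x))" and "t \<equiv> (r * D / CARD('n)) powr (1 / r)"
  assumes int_q: "integrable (P \<Otimes>\<^sub>M noise N r) (\<lambda>(x, z). ln (q (x + t *\<^sub>R z)))"
  shows "rate_distortion f N r D \<le> ereal (R_SLB f N r D - diff_entropy f
      - (\<integral>(x, z). ln (q (x + t *\<^sub>R z)) \<partial>(P \<Otimes>\<^sub>M noise N r)) + c - 1)"
proof -
  note [measurable] = is_norm_measurable[OF N]
  have t: "t > 0" using r D by (simp add: t_def)
  have tr: "t powr (- r) * D = CARD('n) / r" "t powr r * (CARD('n) / r) = D"
    using r D by (simp_all add: t_def powr_powr powr_minus)
  define A where "A = t ^ CARD('n) * norm_mass N r"
  have A: "A > 0" using norm_mass_pos[OF N r] t by (simp add: A_def)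
  define k where "k z = exp (- (t powr (- r) * N z powr r)) / A" for z
  have k_meas [measurable]: "k \<in> borel_measurable borel" unfolding k_def by measurable
  have k0: "k z > 0" for z using A by (simp add: k_def)
  have k_le: "k z \<le> 1 / A" for z using A by (simp add: k_def divide_right_mono)
  have k1: "(\<integral>\<^sup>+x. ennreal (k x) \<partial>lborel) = 1"
  proof -
    have "(\<integral>\<^sup>+x. ennreal (k x) \<partial>lborel) = (\<integral>\<^sup>+x. ennreal (exp (- (t powr (- r) * N (x - 0) powr r))) / ennreal A \<partial>lborel)"
      using A by (intro nn_integral_cong) (simp add: k_def divide_ennreal)
    also have "\<dots> = (\<integral>\<^sup>+x. ennreal (exp (- (t powr (- r) * N (x - 0) powr r))) \<partial>lborel) / ennreal A"
      by (rule nn_integral_divide) measurable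
    also have "\<dots> = 1"
      using t norm_mass_pos[OF N r] unfolding nn_integral_exp_norm_scaled[OF N r t] by (simp add: A_def divide_ennreal)
    finally show ?thesis .
  qed
  have kt: "t ^ CARD('n) * k (t *\<^sub>R z) = exp (- (N z powr r)) / norm_mass N r" for z
  proof -
    have "t powr (- r) * (t * N z) powr r = N z powr r"
      using t is_normD(1)[OF N, of z] by (simp add: powr_mult powr_minus field_simps)
    then show ?thesis using t by (simp add: k_def A_def is_normD(3)[OF N])
  qed
  define \<nu> where "\<nu> = density lborel (\<lambda>x. ennreal (k x))"
  have [measurable_cong]: "sets \<nu> = sets borel" by (simp add: \<nu>_def)
  \<comment> \<open>Identifies the density \<open>k\<close> with the law of the scaled noise, so
    that integrals over \<open>\<nu>\<close> become integrals over the fixed measure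
    \<open>noise N r\<close>.\<close>
  have \<nu>_distr: "\<nu> = distr (noise N r) borel (\<lambda>z. t *\<^sub>R z)"
  proof (rule measure_eqI)
    fix B assume "B \<in> sets \<nu>"
    then have [measurable]: "B \<in> sets borel" by (simp add: \<nu>_def)
    have "emeasure \<nu> B = (\<integral>\<^sup>+x. ennreal (k x) * indicator B x \<partial>lborel)"
      by (simp add: \<nu>_def emeasure_density)
    also have "\<dots> = ennreal (t ^ CARD('n)) * (\<integral>\<^sup>+z. ennreal (k (t *\<^sub>R z)) * indicator B (t *\<^sub>R z) \<partial>lborel)"
      using t by (subst nn_integral_lborel_affine[of _ t 0]) auto
    also have "\<dots> = (\<integral>\<^sup>+z. ennreal (exp (- (N z powr r)) / norm_mass N r) * indicator B (t *\<^sub>R z) \<partial>lborel)"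
      using t k0 by (subst nn_integral_cmult[symmetric])
        (auto intro!: nn_integral_cong simp: kt[symmetric] ennreal_mult less_imp_le mult.assoc)
    also have "\<dots> = (\<integral>\<^sup>+z. indicator B (t *\<^sub>R z) \<partial>noise N r)"
      unfolding noise_def by (subst nn_integral_density) auto
    also have "\<dots> = (\<integral>\<^sup>+z. indicator B z \<partial>distr (noise N r) borel (\<lambda>z. t *\<^sub>R z))"
      by (rule nn_integral_distr[symmetric]) auto
    also have "\<dots> = emeasure (distr (noise N r) borel (\<lambda>z. t *\<^sub>R z)) B" by simp
    finally show "emeasure \<nu> B = emeasure (distr (noise N r) borel (\<lambda>z. t *\<^sub>R z)) B" .
  qed (simp add: \<nu>_def)
  have P: "prob_space P" "sets P = sets borel"
    using f1 by (auto intro!: prob_spaceI simp: emeasure_density P_def)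
  note [measurable_cong] = P(2)
  interpret P: prob_space P by fact
  interpret Z: prob_space "noise N r" by (rule prob_space_noise[OF N r])
  interpret \<nu>: prob_space \<nu> unfolding \<nu>_distr by (rule Z.prob_space_distr) simp
  have P\<nu>: "P \<Otimes>\<^sub>M \<nu> = distr (P \<Otimes>\<^sub>M noise N r) (borel \<Otimes>\<^sub>M borel) (\<lambda>(x, z). (x, t *\<^sub>R z))"
  proof -
    have "P \<Otimes>\<^sub>M \<nu> = distr P borel (\<lambda>x. x) \<Otimes>\<^sub>M distr (noise N r) borel (\<lambda>z. t *\<^sub>R z)"
      using P(2) by (simp add: \<nu>_distr distr_id2)
    also have "\<dots> = distr (P \<Otimes>\<^sub>M noise N r) (borel \<Otimes>\<^sub>M borel) (\<lambda>(x, z). (x, t *\<^sub>R z))"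
      by (rule pair_measure_distr) (use \<nu>.sigma_finite_measure_axioms in \<open>auto simp: \<nu>_distr\<close>)
    finally show ?thesis .
  qed
  have int_q': "integrable (P \<Otimes>\<^sub>M \<nu>) (\<lambda>(x, z). ln (q (x + z)))"
    and q_eq: "(\<integral>(x, z). ln (q (x + z)) \<partial>(P \<Otimes>\<^sub>M \<nu>)) = (\<integral>(x, z). ln (q (x + t *\<^sub>R z)) \<partial>(P \<Otimes>\<^sub>M noise N r))"
    using int_q unfolding P\<nu>
    by (subst integrable_distr_eq; simp add: case_prod_unfold) (subst integral_distr; simp add: case_prod_unfold)
  have nu_norm: "(\<integral>\<^sup>+z. ennreal (N z powr r) \<partial>\<nu>) = ennreal D"
  proof -
    have "(\<integral>\<^sup>+z. ennreal (N z powr r) \<partial>\<nu>) = (\<integral>\<^sup>+z. ennreal (t powr r) * ennreal (N z powr r) \<partial>noise N r)"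
      unfolding \<nu>_distr using t
      by (subst nn_integral_distr) (auto intro!: nn_integral_cong simp: is_normD(1,3)[OF N] powr_mult ennreal_mult)
    also have "\<dots> = ennreal (t powr r) * ennreal (CARD('n) / r)"
      using nn_integral_noise_norm[OF N r] by (subst nn_integral_cmult) auto
    also have "\<dots> = ennreal D" using tr(2) by (simp add: ennreal_mult'[symmetric])
    finally show ?thesis .
  qed
  then have int_N: "integrable \<nu> (\<lambda>z. N z powr r)" and N_eq: "(\<integral>z. N z powr r \<partial>\<nu>) = D"
    using D by (auto intro!: integrableI_nonneg simp: integral_eq_nn_integral)
  have lnk: "ln (k z) = - (t powr (- r) * N z powr r) - ln A" for z
    using A by (simp add: k_def ln_div)
  have int_k: "integrable \<nu> (\<lambda>z. ln (k z))"
    unfolding lnk using int_N by auto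
  have k_eq: "(\<integral>z. ln (k z) \<partial>\<nu>) = - (CARD('n) / r) - ln A"
    unfolding lnk using int_N by (simp add: N_eq \<nu>.prob_space tr)
  define K where "K x = distr \<nu> borel (\<lambda>z. x + z)" for x
  note add = mutual_info_additive_noise_le[OF \<open>f \<in> borel_measurable borel\<close> k_meas \<open>q \<in> borel_measurable borel\<close>
      f0 f1 k0 k_le k1 q0 q1 c0, folded P_def \<nu>_def, OF int_k int_q', folded K_def]
  have "(\<integral>\<^sup>+z. ennreal (N (fst z - snd z) powr r) \<partial>joint_dist P K) \<le> ennreal D"
  proof -
    have "(\<integral>\<^sup>+z. ennreal (N (fst z - snd z) powr r) \<partial>joint_dist P K)
        = (\<integral>\<^sup>+z. ennreal (N (snd z) powr r) \<partial>(P \<Otimes>\<^sub>M \<nu>))"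
      unfolding add(2)
      by (subst nn_integral_distr) (auto intro!: nn_integral_cong simp: is_norm_minus[OF N])
    also have "\<dots> = (\<integral>\<^sup>+x. (\<integral>\<^sup>+z. ennreal (N z powr r) \<partial>\<nu>) \<partial>P)"
      by (subst \<nu>.nn_integral_fst[symmetric]) auto
    also have "\<dots> = ennreal D" by (simp add: nu_norm P.emeasure_space_1)
    finally show ?thesis by simp
  qed
  then have "rate_distortion f N r D \<le> mutual_info (joint_dist P K)"
    unfolding rate_distortion_def P_def[symmetric] using add(1) by (intro INF_lower) auto
  also note add(3)
  finally show ?thesis
    unfolding k_eq q_eq R_SLB_alt[OF N r D] t_def[symmetric] A_def[symmetric] by (simp add: algebra_simps)
qed

section \<open>Reference densities\<close>

text \<open>After division by \<open>x + y\<close> this is \<open>u \<le> u powr a\<close> on the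
  unit interval, applied to two fractions with sum 1.\<close>

lemma powr_add_le_add_powr:
  fixes x y a :: real
  assumes "0 \<le> x" "0 \<le> y" "0 < a" "a \<le> 1"
  shows "(x + y) powr a \<le> x powr a + y powr a"
proof (cases "x + y = 0")
  case False
  then have s: "x + y > 0" using assms by simp
  have *: "u \<le> u powr a" if "0 \<le> u" "u \<le> 1" for u :: real
    using that assms powr_mono'[of a 1 u] by (cases "u = 0") auto
  have "1 = x / (x + y) + y / (x + y)" using s by (simp add: add_divide_distrib[symmetric])
  also have "\<dots> \<le> (x / (x + y)) powr a + (y / (x + y)) powr a"
    using s assms by (intro add_mono *) auto
  also have "\<dots> = (x powr a + y powr a) / (x + y) powr a"
    using s assms by (simp add: powr_divide add_divide_distrib)
  finally show ?thesis using s by (simp add: field_simps)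
qed (use assms in auto)

text \<open>The convolution with an unnormalised kernel. For a probability density \<open>f\<close>
  and \<open>\<rho> \<ge> 0\<close> the integral is at most 1, so \<open>enn2real\<close> does not
  alter it.\<close>

definition smoothed :: "('a::euclidean_space \<Rightarrow> real) \<Rightarrow> ('a \<Rightarrow> real) \<Rightarrow> 'a \<Rightarrow> real" where
  "smoothed \<rho> f y = enn2real (\<integral>\<^sup>+x. ennreal (f x * exp (- \<rho> (x - y))) \<partial>lborel)"

context
  fixes f \<rho> :: "'a::euclidean_space \<Rightarrow> real"
  assumes f_meas [measurable]: "f \<in> borel_measurable borel"
    and \<rho>_meas [measurable]: "\<rho> \<in> borel_measurable borel"
    and f0: "\<And>x. f x \<ge> 0" and f1: "(\<integral>\<^sup>+x. ennreal (f x) \<partial>lborel) = 1"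
    and \<rho>0: "\<And>x. \<rho> x \<ge> 0" and \<rho>_minus: "\<And>x. \<rho> (- x) = \<rho> x" and \<rho>_add: "\<And>x y. \<rho> (x + y) \<le> \<rho> x + \<rho> y"
begin

lemma smoothed_measurable [measurable]: "smoothed \<rho> f \<in> borel_measurable borel"
  unfolding smoothed_def by measurable

lemma
  shows smoothed_pos: "smoothed \<rho> f y > 0" and smoothed_le_1: "smoothed \<rho> f y \<le> 1"
    and ennreal_smoothed: "ennreal (smoothed \<rho> f y) = (\<integral>\<^sup>+x. ennreal (f x * exp (- \<rho> (x - y))) \<partial>lborel)"
proof -
  have *: "0 < (\<integral>\<^sup>+x. ennreal (f x * exp (- \<rho> (x - y))) \<partial>lborel)"
    "(\<integral>\<^sup>+x. ennreal (f x * exp (- \<rho> (x - y))) \<partial>lborel) \<le> ennreal 1"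
    using nn_integral_prob_density_mult[of f lborel "\<lambda>x. exp (- \<rho> (x - y))" 1] f0 f1 \<rho>0 by simp_all
  then show eq: "ennreal (smoothed \<rho> f y) = (\<integral>\<^sup>+x. ennreal (f x * exp (- \<rho> (x - y))) \<partial>lborel)"
    unfolding smoothed_def by (simp add: order_le_less_trans)
  show "smoothed \<rho> f y > 0" using *(1) unfolding eq[symmetric] by simp
  show "smoothed \<rho> f y \<le> 1" using *(2) unfolding eq[symmetric] by simp
qed

text \<open>A Harnack-type inequality: subadditivity gives
  \<open>\<rho> (x - (y + z)) \<le> \<rho> (x - y) + \<rho> z\<close> under the integral. A shift by
  \<open>z\<close> therefore lowers the logarithm by at most \<open>\<rho> z\<close>.\<close>

lemma smoothed_shift: "exp (- \<rho> z) * smoothed \<rho> f y \<le> smoothed \<rho> f (y + z)"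
proof -
  have "ennreal (exp (- \<rho> z)) * ennreal (smoothed \<rho> f y) =
      (\<integral>\<^sup>+x. ennreal (exp (- \<rho> z)) * ennreal (f x * exp (- \<rho> (x - y))) \<partial>lborel)"
    unfolding ennreal_smoothed by (rule nn_integral_cmult[symmetric]) simp
  also have "\<dots> \<le> (\<integral>\<^sup>+x. ennreal (f x * exp (- \<rho> (x - (y + z)))) \<partial>lborel)"
  proof (intro nn_integral_mono)
    fix x
    have "\<rho> (x - (y + z)) \<le> \<rho> (x - y) + \<rho> z"
      using \<rho>_add[of "x - y" "- z"] \<rho>_minus[of z] by (simp add: algebra_simps)
    then have "exp (- \<rho> z) * exp (- \<rho> (x - y)) \<le> exp (- \<rho> (x - (y + z)))"
      by (simp add: exp_add[symmetric])
    then have "f x * (exp (- \<rho> z) * exp (- \<rho> (x - y))) \<le> f x * exp (- \<rho> (x - (y + z)))"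
      by (intro mult_left_mono f0)
    then show "ennreal (exp (- \<rho> z)) * ennreal (f x * exp (- \<rho> (x - y))) \<le> ennreal (f x * exp (- \<rho> (x - (y + z))))"
      using f0[of x] by (simp add: ennreal_mult[symmetric] ennreal_leI mult_ac)
  qed
  also have "\<dots> = ennreal (smoothed \<rho> f (y + z))" by (simp add: ennreal_smoothed)
  finally have "ennreal (exp (- \<rho> z) * smoothed \<rho> f y) \<le> ennreal (smoothed \<rho> f (y + z))"
    using smoothed_pos by (simp add: ennreal_mult less_imp_le)
  then show ?thesis using smoothed_pos[of "y + z"] by (simp add: ennreal_le_iff less_imp_le)
qed

text \<open>The shift inequality in both directions, with \<open>smoothed \<rho> f \<le> 1\<close>,
  gives the modulus of continuity \<open>exp (\<rho> (x - y)) - 1\<close>.\<close>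

lemma continuous_on_smoothed:
  assumes "(\<rho> \<longlongrightarrow> 0) (at 0)"
  shows "continuous_on UNIV (smoothed \<rho> f)"
proof -
  have diff: "smoothed \<rho> f x - smoothed \<rho> f y \<le> exp (\<rho> (y - x)) - 1" for x y
  proof -
    have "smoothed \<rho> f x - smoothed \<rho> f y \<le> smoothed \<rho> f y * (exp (\<rho> (y - x)) - 1)"
      using smoothed_shift[of "y - x" x] by (simp add: exp_minus field_simps)
    also have "\<dots> \<le> 1 * (exp (\<rho> (y - x)) - 1)"
      using \<rho>0 smoothed_le_1 by (intro mult_right_mono) auto
    finally show ?thesis by simp
  qed
  have "isCont (smoothed \<rho> f) y" for y
    unfolding isCont_def
  proof (rule Lim_transform_bound[OF _ _, THEN Lim_null[THEN iffD2]])
    show "\<forall>\<^sub>F x in at y. norm (smoothed \<rho> f x - smoothed \<rho> f y) \<le> norm (exp (\<rho> (x - y)) - 1)"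
    proof (rule always_eventually, rule allI)
      fix x
      have "\<rho> (y - x) = \<rho> (x - y)" using \<rho>_minus[of "x - y"] by simp
      then show "norm (smoothed \<rho> f x - smoothed \<rho> f y) \<le> norm (exp (\<rho> (x - y)) - 1)"
        using diff[of x y] diff[of y x] \<rho>0[of "x - y"] by (simp add: abs_le_iff)
    qed
    have "((\<lambda>x. \<rho> (x - y)) \<longlongrightarrow> 0) (at y)"
      using LIM_offset_zero_iff[of y "\<lambda>x. \<rho> (x - y)" 0] assms by simp
    then have "((\<lambda>x. exp (\<rho> (x - y)) - 1) \<longlongrightarrow> exp 0 - 1) (at y)"
      by (intro tendsto_intros)
    then show "((\<lambda>x. exp (\<rho> (x - y)) - 1) \<longlongrightarrow> 0) (at y)" by simp
  qed
  then show ?thesis by (simp add: continuous_at_imp_continuous_on)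
qed

lemma nn_integral_smoothed:
  "(\<integral>\<^sup>+y. ennreal (smoothed \<rho> f y) \<partial>lborel) = (\<integral>\<^sup>+z. ennreal (exp (- \<rho> z)) \<partial>lborel)"
proof -
  have "(\<integral>\<^sup>+y. ennreal (smoothed \<rho> f y) \<partial>lborel) = (\<integral>\<^sup>+x. (\<integral>\<^sup>+y. ennreal (f x * exp (- \<rho> (x - y))) \<partial>lborel) \<partial>lborel)"
    unfolding ennreal_smoothed by (rule lborel_pair.Fubini') measurable
  also have "\<dots> = (\<integral>\<^sup>+x. ennreal (f x) * (\<integral>\<^sup>+z. ennreal (exp (- \<rho> z)) \<partial>lborel) \<partial>lborel)"
  proof (intro nn_integral_cong)
    fix x
    have "(\<integral>\<^sup>+y. ennreal (f x * exp (- \<rho> (x - y))) \<partial>lborel) = ennreal (f x) * (\<integral>\<^sup>+y. ennreal (exp (- \<rho> (y - x))) \<partial>lborel)"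
      using f0 \<rho>_minus[of "x - y" for y]
      by (subst nn_integral_cmult[symmetric]) (auto intro!: nn_integral_cong simp: ennreal_mult)
    also have "(\<integral>\<^sup>+y. ennreal (exp (- \<rho> (y - x))) \<partial>lborel) = (\<integral>\<^sup>+z. ennreal (exp (- \<rho> z)) \<partial>lborel)"
      by (subst nn_integral_lborel_affine[of _ 1 x]) auto
    finally show "(\<integral>\<^sup>+y. ennreal (f x * exp (- \<rho> (x - y))) \<partial>lborel) = ennreal (f x) * (\<integral>\<^sup>+z. ennreal (exp (- \<rho> z)) \<partial>lborel)" .
  qed
  also have "\<dots> = (\<integral>\<^sup>+z. ennreal (exp (- \<rho> z)) \<partial>lborel)"
    by (simp add: nn_integral_multc f1)
  finally show ?thesis .
qed

end

text \<open>The source mass in the cell of \<open>x\<close> alone gives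
  \<open>exp (- b) * p x \<le> smoothed \<rho> f x\<close>. Hence
  \<open>- ln (smoothed \<rho> f x)\<close> is almost surely at most
  \<open>\<bar>b\<bar> - ln (p x)\<close>, whose mean is \<open>\<bar>b\<bar>\<close> plus the floor
  entropy.\<close>

lemma integrable_ln_smoothed:
  fixes f \<rho> :: "real^'n \<Rightarrow> real"
  assumes [measurable]: "f \<in> borel_measurable borel" "\<rho> \<in> borel_measurable borel"
    and f0: "\<And>x. f x \<ge> 0" and f1: "(\<integral>\<^sup>+x. ennreal (f x) \<partial>lborel) = 1"
    and \<rho>0: "\<And>x. \<rho> x \<ge> 0" and \<rho>_minus: "\<And>x. \<rho> (- x) = \<rho> x" and \<rho>_add: "\<And>x y. \<rho> (x + y) \<le> \<rho> x + \<rho> y"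
    and b: "\<And>x y. vfloor x = vfloor y \<Longrightarrow> \<rho> (x - y) \<le> b"
    and H: "floor_entropy f < \<infinity>"
  defines "P \<equiv> density lborel (\<lambda>x. ennreal (f x))"
  shows "integrable P (\<lambda>x. ln (smoothed \<rho> f x))"
proof -
  note w = smoothed_measurable[OF assms(1-7)] smoothed_pos[OF assms(1-7)] smoothed_le_1[OF assms(1-7)]
  note [measurable] = w(1)
  have [measurable_cong]: "sets P = sets borel" and [simp]: "space P = UNIV" by (simp_all add: P_def)
  interpret P: prob_space P
    using f1 by (auto intro!: prob_spaceI simp: emeasure_density P_def)
  define p where "p x = measure P (vfloor -` {vfloor x})" for x :: "real^'n"
  have [measurable]: "p \<in> borel_measurable borel"
  proof -
    have "(\<lambda>x. (\<lambda>k. measure P (vfloor -` {k})) (vfloor x)) \<in> borel_measurable borel"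
      by measurable
    then show ?thesis by (simp add: p_def[abs_def])
  qed
  \<comment> \<open>Countably many null cells form a null set; outside it the convention
    \<open>ln 0 = 0\<close> cannot spoil the comparison of logarithms.\<close>
  have p_pos: "AE x in P. p x > 0"
  proof -
    let ?Z = "{k. measure P (vfloor -` {k}) = 0}"
    have "(\<Union>k\<in>?Z. vfloor -` {k}) \<in> null_sets P"
      by (intro null_sets_UN' countable_subset[OF subset_UNIV countable_UNIV_int_vec])
        (auto simp: null_sets_def P.emeasure_eq_measure)
    moreover have "{x \<in> space P. \<not> p x > 0} \<subseteq> (\<Union>k\<in>?Z. vfloor -` {k})"
      by (auto simp: p_def not_less measure_le_0_iff)
    ultimately show ?thesis by (rule AE_I')
  qed
  have w_ge: "exp (- b) * p x \<le> smoothed \<rho> f x" for x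
  proof -
    have "ennreal (exp (- b) * p x) = ennreal (exp (- b)) * emeasure P (vfloor -` {vfloor x})"
      by (simp add: p_def P.emeasure_eq_measure ennreal_mult)
    also have "\<dots> = (\<integral>\<^sup>+y. ennreal (exp (- b)) * (ennreal (f y) * indicator (vfloor -` {vfloor x}) y) \<partial>lborel)"
      unfolding P_def by (simp add: emeasure_density nn_integral_cmult)
    also have "\<dots> \<le> (\<integral>\<^sup>+y. ennreal (f y * exp (- \<rho> (y - x))) \<partial>lborel)"
      using f0 b by (intro nn_integral_mono)
        (auto simp: indicator_def ennreal_mult[symmetric] mult.commute[of "exp (- b)"] intro!: ennreal_leI mult_left_mono)
    also have "\<dots> = ennreal (smoothed \<rho> f x)" by (simp add: ennreal_smoothed[OF assms(1-7)])
    finally show ?thesis using w(2)[of x] by (simp add: ennreal_le_iff less_imp_le)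
  qed
  have "(\<integral>\<^sup>+x. ennreal (- ln (smoothed \<rho> f x)) \<partial>P) \<le> (\<integral>\<^sup>+x. ennreal \<bar>b\<bar> + ennreal (- ln (p x)) \<partial>P)"
  proof (intro nn_integral_mono_AE)
    show "AE x in P. ennreal (- ln (smoothed \<rho> f x)) \<le> ennreal \<bar>b\<bar> + ennreal (- ln (p x))"
      using p_pos
    proof eventually_elim
      case (elim x)
      then have "- b + ln (p x) = ln (exp (- b) * p x)" by (simp add: ln_mult)
      also have "\<dots> \<le> ln (smoothed \<rho> f x)" using w_ge[of x] elim by (intro ln_mono) auto
      finally have "- ln (smoothed \<rho> f x) \<le> \<bar>b\<bar> + (- ln (p x))" by simp
      moreover have "p x \<le> 1" by (simp add: p_def)
      ultimately show ?case using elim by (simp add: ennreal_plus[symmetric] ennreal_leI del: ennreal_plus)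
    qed
  qed
  also have "\<dots> = ennreal \<bar>b\<bar> + floor_entropy f"
    using floor_entropy_eq[OF _ f1] by (subst nn_integral_add) (auto simp: P_def[symmetric] p_def P.emeasure_space_1[simplified])
  also have "\<dots> < \<infinity>" using H by simp
  finally have "integrable P (\<lambda>x. - ln (smoothed \<rho> f x))"
    using w(2,3) by (intro integrableI_nonneg) auto
  then show ?thesis by simp
qed

text \<open>A Lebesgue measurable function is \<open>measurable_on\<close>, that is, a limit of
  continuous functions off a negligible set; the almost everywhere statement then passes from the
  completion back to \<open>lborel\<close>.\<close>

lemma AE_lborel_continuous_approx:
  fixes f :: "'a::euclidean_space \<Rightarrow> real"
  assumes "f \<in> borel_measurable borel"
  obtains g where "\<And>n :: nat. continuous_on UNIV (g n)" "AE x in lborel. (\<lambda>n. g n x) \<longlonglongrightarrow> f x"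
proof -
  have "f \<in> borel_measurable lebesgue" using assms by (simp add: measurable_completion)
  then have "f measurable_on UNIV"
    by (intro lebesgue_measurable_imp_measurable_on_real) auto
  then obtain S g where S: "negligible S" and g: "\<And>n. continuous_on UNIV (g n)"
    and lim: "\<And>x. x \<notin> S \<Longrightarrow> (\<lambda>n. g n x) \<longlonglongrightarrow> f x"
    unfolding measurable_on_def by auto
  have "AE x in lebesgue. x \<notin> S" using S by (intro AE_not_in) (simp add: negligible_iff_null_sets)
  then have "AE x in lborel. x \<notin> S" by (simp add: AE_completion_iff)
  then have "AE x in lborel. (\<lambda>n. g n x) \<longlonglongrightarrow> f x" by eventually_elim (rule lim)
  with g show ?thesis by (rule that)
qed

text \<open>Two approximations: \<open>f\<close> is clipped from above by the integrable envelope
  \<open>real m * e x\<close>, and the clipped function is approximated by continuous ones under the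
  same envelope. The summand \<open>\<delta> * w x\<close> keeps the logarithms above an integrable
  function, so both limits pass under the integral.\<close>

lemma exists_reference_density:
  fixes f w e :: "'a::euclidean_space \<Rightarrow> real"
  assumes f_meas [measurable]: "f \<in> borel_measurable borel"
    and f0: "\<And>x. f x \<ge> 0" and f1: "(\<integral>\<^sup>+x. ennreal (f x) \<partial>lborel) = 1"
  defines "P \<equiv> density lborel (\<lambda>x. ennreal (f x))"
  assumes int_f: "integrable P (\<lambda>x. ln (f x))" and int_w: "integrable P (\<lambda>x. ln (w x))"
    and w: "continuous_on UNIV w" "\<And>x. w x > 0" "\<And>x. w x \<le> 1" "(\<integral>\<^sup>+x. ennreal (w x) \<partial>lborel) \<le> ennreal L"
    and e: "continuous_on UNIV e" "\<And>x. e x > 0" "\<And>x. e x \<le> 1" "integrable lborel e"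
    and L: "L > 0" and \<epsilon>: "\<epsilon> > 0"
  obtains q \<delta> M c where "continuous_on UNIV q" "\<delta> > 0" "\<And>x. \<delta> * w x \<le> q x" "\<And>x. q x \<le> M"
    "(\<integral>\<^sup>+x. ennreal (q x) \<partial>lborel) \<le> ennreal c" "c \<ge> 0"
    "(\<integral>x. ln (f x) \<partial>P) - (\<integral>x. ln (q x) \<partial>P) + c - 1 < \<epsilon>"
proof -
  have [measurable]: "w \<in> borel_measurable borel" "e \<in> borel_measurable borel"
    using w(1) e(1) by (auto intro: borel_measurable_continuous_onI)
  have [measurable_cong]: "sets P = sets borel" and [simp]: "space P = UNIV" by (simp_all add: P_def)
  interpret P: prob_space P
    using f1 by (auto intro!: prob_spaceI simp: emeasure_density P_def)
  \<comment> \<open>Half of \<open>\<epsilon>\<close> pays for the mass bound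
    \<open>\<delta> * L\<close> of the added term, the other half for the approximation of
    \<open>f\<close>.\<close>
  define \<delta> where "\<delta> = \<epsilon> / (2 * L)"
  have \<delta>: "\<delta> > 0" "\<delta> * L = \<epsilon> / 2" using \<epsilon> L by (simp_all add: \<delta>_def)
  have ln2: "ln (2::real) \<ge> 0" by simp
  have ln_ge: "- (\<bar>ln \<delta>\<bar> + \<bar>ln (w x)\<bar>) \<le> ln y" if "\<delta> * w x \<le> y" for x y
  proof -
    have "ln \<delta> + ln (w x) = ln (\<delta> * w x)" using \<delta>(1) w(2)[of x] by (simp add: ln_mult)
    also have "\<dots> \<le> ln y" using that \<delta>(1) w(2)[of x] by (intro ln_mono) (auto intro: less_le_trans[OF mult_pos_pos])
    finally show ?thesis by linarith
  qed
  \<comment> \<open>A sum of two positive terms is at most twice the larger one, hence the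
    \<open>ln 2\<close>. Where \<open>f x = 0\<close>, the convention \<open>ln 0 = 0\<close> makes
    \<open>\<bar>ln (f x)\<bar>\<close> vanish, and \<open>\<delta> * w x\<close> alone gives the
    bound.\<close>
  have ln_le: "ln (f x + \<delta> * w x) \<le> ln 2 + \<bar>ln (f x)\<bar> + \<bar>ln \<delta>\<bar> + \<bar>ln (w x)\<bar>" for x
  proof -
    have dw: "\<delta> * w x > 0" "ln (\<delta> * w x) = ln \<delta> + ln (w x)"
      using \<delta>(1) w(2)[of x] by (simp_all add: ln_mult)
    show ?thesis
    proof (cases "f x = 0")
      case False
      then have fx: "f x > 0" using f0[of x] by simp
      have "ln (f x + \<delta> * w x) \<le> ln (2 * max (f x) (\<delta> * w x))"
        using fx dw by (intro ln_mono) auto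
      also have "\<dots> = ln 2 + max (ln (f x)) (ln (\<delta> * w x))"
        using fx dw(1) by (subst ln_mult) (auto simp: max_def)
      finally show ?thesis using dw by linarith
    next
      case True
      have "ln (f x + \<delta> * w x) = ln \<delta> + ln (w x)" using dw(2) True by simp
      then show ?thesis using ln2 by linarith
    qed
  qed
  define u where "u n x = min (f x) (real n * e x)" for n x
  have [measurable]: "u n \<in> borel_measurable borel" for n unfolding u_def by measurable
  have u0: "u n x \<ge> 0" for n x using f0[of x] e(2)[of x] by (simp add: u_def)
  let ?dom = "\<lambda>x. ln 2 + \<bar>ln (f x)\<bar> + \<bar>ln \<delta>\<bar> + \<bar>ln (w x)\<bar>"
  have dom: "integrable P ?dom" using int_f int_w by auto
  have ln_u: "\<bar>ln (u n x + \<delta> * w x)\<bar> \<le> ?dom x" for n x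
  proof -
    have "\<delta> * w x > 0" using \<delta>(1) w(2)[of x] by simp
    then have "ln (u n x + \<delta> * w x) \<le> ln (f x + \<delta> * w x)"
      using u0[of n x] by (intro ln_mono) (auto simp: u_def)
    then show ?thesis
      using ln_le[of x] ln_ge[of x "u n x + \<delta> * w x"] u0[of n x] ln2 by (intro abs_leI) linarith+
  qed
  have lim1: "(\<lambda>n. \<integral>x. ln (u n x + \<delta> * w x) \<partial>P) \<longlonglongrightarrow> (\<integral>x. ln (f x + \<delta> * w x) \<partial>P)"
  proof (rule integral_dominated_convergence[OF _ _ dom])
    show "AE x in P. (\<lambda>n. ln (u n x + \<delta> * w x)) \<longlonglongrightarrow> ln (f x + \<delta> * w x)"
    proof (intro AE_I2)
      fix x
      obtain n0 :: nat where n0: "f x / e x \<le> n0" using real_arch_simple by blast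
      have "u n x = f x" if "n \<ge> n0" for n
      proof -
        have "f x / e x \<le> real n" using n0 that by linarith
        then show ?thesis using e(2)[of x] by (simp add: u_def field_simps)
      qed
      then have "\<forall>\<^sub>F n in sequentially. ln (u n x + \<delta> * w x) = ln (f x + \<delta> * w x)"
        unfolding eventually_sequentially by (intro exI[of _ n0]) auto
      then show "(\<lambda>n. ln (u n x + \<delta> * w x)) \<longlonglongrightarrow> ln (f x + \<delta> * w x)"
        by (rule tendsto_eventually)
    qed
  qed (use ln_u in auto)
  \<comment> \<open>Adding \<open>\<delta> * w x\<close> raises the logarithm wherever
    \<open>f x > 0\<close>, hence almost surely. So the limit in \<open>lim1\<close> is at least the
    mean of \<open>ln (f x)\<close>, and some clipping level \<open>m\<close> loses less than
    \<open>\<epsilon> / 2\<close>.\<close>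
  have "(\<integral>x. ln (f x) \<partial>P) \<le> (\<integral>x. ln (f x + \<delta> * w x) \<partial>P)"
  proof (rule integral_mono_AE[OF int_f])
    show "integrable P (\<lambda>x. ln (f x + \<delta> * w x))"
    proof (rule Bochner_Integration.integrable_bound[OF dom])
      show "AE x in P. norm (ln (f x + \<delta> * w x)) \<le> norm (?dom x)"
      proof (intro AE_I2)
        fix x
        have "- (\<bar>ln \<delta>\<bar> + \<bar>ln (w x)\<bar>) \<le> ln (f x + \<delta> * w x)" using f0[of x] by (intro ln_ge) simp
        then show "norm (ln (f x + \<delta> * w x)) \<le> norm (?dom x)" using ln_le[of x] ln2 unfolding real_norm_def by (intro abs_leI) linarith+
      qed
    qed simp
    have "AE x in P. f x > 0"
      by (rule AE_density_pos[of f lborel]) (use f0 in \<open>simp_all add: P_def\<close>)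
    then show "AE x in P. ln (f x) \<le> ln (f x + \<delta> * w x)"
    proof eventually_elim
      case (elim x)
      then show ?case using \<delta>(1) w(2)[of x] by (intro ln_mono) (auto intro: add_pos_pos)
    qed
  qed
  then have "(\<integral>x. ln (f x) \<partial>P) - \<epsilon> / 2 < (\<integral>x. ln (f x + \<delta> * w x) \<partial>P)" using \<epsilon> by simp
  then have "\<forall>\<^sub>F n in sequentially. (\<integral>x. ln (f x) \<partial>P) - \<epsilon> / 2 < (\<integral>x. ln (u n x + \<delta> * w x) \<partial>P)"
    by (rule order_tendstoD(1)[OF lim1])
  then obtain m where m: "(\<integral>x. ln (f x) \<partial>P) - \<epsilon> / 2 < (\<integral>x. ln (u m x + \<delta> * w x) \<partial>P)"
    using eventually_happens'[OF sequentially_bot] by blast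
  obtain g where g: "\<And>n :: nat. continuous_on UNIV (g n)" "AE x in lborel. (\<lambda>n. g n x) \<longlonglongrightarrow> f x"
    using AE_lborel_continuous_approx[OF f_meas] by blast
  \<comment> \<open>Clipping \<open>g n\<close> between 0 and the envelope keeps it continuous,
    makes it converge to \<open>u m\<close>, and gives one integrable bound for all
    \<open>n\<close>.\<close>
  define v where "v n x = min (max (g n x) 0) (real m * e x)" for n x
  have v_cont: "continuous_on UNIV (v n)" for n
    unfolding v_def by (intro continuous_intros g e)
  then have [measurable]: "v n \<in> borel_measurable borel" for n by (intro borel_measurable_continuous_onI)
  have v0: "v n x \<ge> 0" "v n x \<le> real m * e x" for n x using e(2)[of x] by (auto simp: v_def)
  have v_lim: "AE x in lborel. (\<lambda>n. v n x) \<longlonglongrightarrow> u m x"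
    using g(2)
  proof eventually_elim
    case (elim x)
    then have "(\<lambda>n. min (max (g n x) 0) (real m * e x)) \<longlonglongrightarrow> min (max (f x) 0) (real m * e x)"
      by (intro tendsto_intros)
    then show ?case using f0[of x] by (simp add: v_def u_def)
  qed
  define M where "M = real m + \<delta>"
  define q where "q n x = v n x + \<delta> * w x" for n x
  have q_cont: "continuous_on UNIV (q n)" for n
    unfolding q_def by (intro continuous_intros v_cont w)
  then have [measurable]: "q n \<in> borel_measurable borel" for n by (intro borel_measurable_continuous_onI)
  have q_ge: "\<delta> * w x \<le> q n x" for n x using v0 by (simp add: q_def)
  have q_le: "q n x \<le> M" for n x
  proof -
    have "real m * e x \<le> real m * 1" by (intro mult_left_mono e) simp
    moreover have "\<delta> * w x \<le> \<delta> * 1" using \<delta>(1) by (intro mult_left_mono w) simp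
    ultimately show ?thesis using v0(2)[of n x] by (simp add: q_def M_def)
  qed
  have lim2: "(\<lambda>n. \<integral>x. ln (q n x) \<partial>P) \<longlonglongrightarrow> (\<integral>x. ln (u m x + \<delta> * w x) \<partial>P)"
  proof (rule integral_dominated_convergence)
    show "integrable P (\<lambda>x. \<bar>ln M\<bar> + \<bar>ln \<delta>\<bar> + \<bar>ln (w x)\<bar>)" using int_w by auto
    have "AE x in P. (\<lambda>n. v n x) \<longlonglongrightarrow> u m x"
      using v_lim unfolding P_def by (subst AE_density) (auto elim!: eventually_mono)
    then show "AE x in P. (\<lambda>n. ln (q n x)) \<longlonglongrightarrow> ln (u m x + \<delta> * w x)"
    proof eventually_elim
      case (elim x)
      have "u m x + \<delta> * w x > 0" using u0[of m x] \<delta>(1) w(2)[of x] by (intro add_nonneg_pos) auto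
      then show ?case unfolding q_def by (intro tendsto_intros elim) auto
    qed
    show "AE x in P. norm (ln (q n x)) \<le> \<bar>ln M\<bar> + \<bar>ln \<delta>\<bar> + \<bar>ln (w x)\<bar>" for n
    proof (intro AE_I2)
      fix x
      have "q n x > 0" using q_ge[of x n] \<delta>(1) w(2)[of x] by (auto intro: less_le_trans[OF mult_pos_pos])
      then have "ln (q n x) \<le> ln M" using q_le[of n x] by (intro ln_mono) auto
      then show "norm (ln (q n x)) \<le> \<bar>ln M\<bar> + \<bar>ln \<delta>\<bar> + \<bar>ln (w x)\<bar>"
        using ln_ge[OF q_ge[of x n]] unfolding real_norm_def by (intro abs_leI) linarith+
    qed
  qed simp_all
  have me: "integrable lborel (\<lambda>x. real m * e x)" using e(4) by simp
  have v_int: "integrable lborel (v n)" for n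
    by (rule Bochner_Integration.integrable_bound[OF me])
      (use v0 in \<open>auto intro!: AE_I2 order_trans[OF _ abs_ge_self]\<close>)
  have lim3: "(\<lambda>n. \<integral>x. v n x \<partial>lborel) \<longlonglongrightarrow> (\<integral>x. u m x \<partial>lborel)"
    by (rule integral_dominated_convergence[OF _ _ me v_lim]) (use v0 in auto)
  \<comment> \<open>Since \<open>u m x \<le> f x\<close>, the mass bound for \<open>q n\<close>
    tends to at most \<open>1 + \<epsilon> / 2\<close>, so the term \<open>c - 1\<close> uses only
    the other half of \<open>\<epsilon>\<close>.\<close>
  have "(\<integral>x. u m x \<partial>lborel) \<le> 1"
  proof -
    have f: "integrable lborel f" "(\<integral>x. f x \<partial>lborel) = 1"
      using f0 f1 by (auto intro!: integrableI_nonneg simp: integral_eq_nn_integral)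
    have "u m x \<le> real m * e x" for x by (simp add: u_def)
    then have "integrable lborel (u m)"
      by (intro Bochner_Integration.integrable_bound[OF me])
        (use u0 in \<open>auto intro!: AE_I2 order_trans[OF _ abs_ge_self]\<close>)
    then have "(\<integral>x. u m x \<partial>lborel) \<le> (\<integral>x. f x \<partial>lborel)"
      by (rule integral_mono[OF _ f(1)]) (simp add: u_def)
    then show ?thesis using f(2) by simp
  qed
  then have lt: "(\<integral>x. ln (f x) \<partial>P) - (\<integral>x. ln (u m x + \<delta> * w x) \<partial>P) + ((\<integral>x. u m x \<partial>lborel) + \<delta> * L) - 1 < \<epsilon>"
    using m \<delta>(2) by simp
  have "(\<lambda>n. (\<integral>x. ln (f x) \<partial>P) - (\<integral>x. ln (q n x) \<partial>P) + ((\<integral>x. v n x \<partial>lborel) + \<delta> * L) - 1)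
    \<longlonglongrightarrow> (\<integral>x. ln (f x) \<partial>P) - (\<integral>x. ln (u m x + \<delta> * w x) \<partial>P) + ((\<integral>x. u m x \<partial>lborel) + \<delta> * L) - 1"
    by (intro tendsto_intros lim2 lim3)
  then have "\<forall>\<^sub>F n in sequentially.
      (\<integral>x. ln (f x) \<partial>P) - (\<integral>x. ln (q n x) \<partial>P) + ((\<integral>x. v n x \<partial>lborel) + \<delta> * L) - 1 < \<epsilon>"
    using lt by (rule order_tendstoD(2))
  then obtain n where n: "(\<integral>x. ln (f x) \<partial>P) - (\<integral>x. ln (q n x) \<partial>P) + ((\<integral>x. v n x \<partial>lborel) + \<delta> * L) - 1 < \<epsilon>"
    using eventually_happens'[OF sequentially_bot] by blast
  have vi: "(\<integral>x. v n x \<partial>lborel) \<ge> 0" using v0 by (intro integral_nonneg_AE) auto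
  have "(\<integral>\<^sup>+x. ennreal (q n x) \<partial>lborel) = (\<integral>\<^sup>+x. ennreal (v n x) + ennreal \<delta> * ennreal (w x) \<partial>lborel)"
    using v0 \<delta>(1) w(2) by (intro nn_integral_cong) (simp add: q_def ennreal_mult less_imp_le)
  also have "\<dots> = ennreal (\<integral>x. v n x \<partial>lborel) + ennreal \<delta> * (\<integral>\<^sup>+x. ennreal (w x) \<partial>lborel)"
    using v0 v_int by (subst nn_integral_add) (auto simp: nn_integral_cmult nn_integral_eq_integral)
  also have "\<dots> \<le> ennreal (\<integral>x. v n x \<partial>lborel) + ennreal \<delta> * ennreal L"
    by (intro add_left_mono mult_left_mono w) simp
  also have "\<dots> = ennreal ((\<integral>x. v n x \<partial>lborel) + \<delta> * L)"
    using vi \<delta>(1) L by (simp add: ennreal_mult)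
  finally have "(\<integral>\<^sup>+x. ennreal (q n x) \<partial>lborel) \<le> ennreal ((\<integral>x. v n x \<partial>lborel) + \<delta> * L)" .
  moreover have "(\<integral>x. v n x \<partial>lborel) + \<delta> * L \<ge> 0" using vi \<delta>(1) L by simp
  ultimately show ?thesis using that[OF q_cont \<delta>(1) q_ge q_le _ _ n] by blast
qed

section \<open>Asymptotic tightness\<close>

text \<open>The reference density \<open>q\<close> is fixed first, depending on
  \<open>\<epsilon>\<close> but not on \<open>D\<close>. As \<open>D\<close> tends to 0, dominated
  convergence sends the mean of \<open>ln (q (x + t D *\<^sub>R z))\<close> to that of
  \<open>ln (q x)\<close>, for which the excess over \<open>R_SLB\<close> is below
  \<open>\<epsilon>\<close>.\<close>

lemma eventually_rate_distortion_le:
  fixes f N :: "real^'n \<Rightarrow> real"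
  assumes N: "is_norm N" and r: "r > 0" and f_meas [measurable]: "f \<in> borel_measurable borel"
    and f0: "\<And>x. f x \<ge> 0" and f1: "(\<integral>\<^sup>+x. ennreal (f x) \<partial>lborel) = 1"
    and int: "integrable lborel (\<lambda>x. f x * ln (f x))" and H: "floor_entropy f < \<infinity>" and \<epsilon>: "\<epsilon> > 0"
  shows "\<forall>\<^sub>F D in at_right 0. rate_distortion f N r D \<le> ereal (R_SLB f N r D + \<epsilon>)"
proof -
  note [measurable] = is_norm_measurable[OF N]
  define P where "P = density lborel (\<lambda>x. ennreal (f x))"
  have [measurable_cong]: "sets P = sets borel" by (simp add: P_def)
  interpret P: prob_space P
    using f1 by (auto intro!: prob_spaceI simp: emeasure_density P_def)
  interpret Z: prob_space "noise N r" by (rule prob_space_noise[OF N r])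
  interpret PZ: pair_prob_space P "noise N r" ..
  have int_f: "integrable P (\<lambda>x. ln (f x))"
    unfolding P_def using int f0 by (subst integrable_density) auto
  have h: "diff_entropy f = - (\<integral>x. ln (f x) \<partial>P)"
    unfolding P_def using f0 by (simp add: diff_entropy_def integral_density)
  \<comment> \<open>The exponent is cut off at 1 to make \<open>\<rho>\<close> subadditive.\<close>
  define a where "a = min r 1"
  have a: "0 < a" "a \<le> 1" "a \<le> r" using r by (auto simp: a_def)
  define \<rho> where "\<rho> z = N z powr a" for z
  have [measurable]: "\<rho> \<in> borel_measurable borel" unfolding \<rho>_def by measurable
  have \<rho>0: "\<rho> z \<ge> 0" and \<rho>_minus: "\<rho> (- z) = \<rho> z" for z
    by (simp_all add: \<rho>_def is_norm_minus[OF N])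
  have \<rho>_add: "\<rho> (x + y) \<le> \<rho> x + \<rho> y" for x y
  proof -
    have "\<rho> (x + y) \<le> (N x + N y) powr a"
      unfolding \<rho>_def using a is_normD(1,4)[OF N] by (intro powr_mono2) auto
    also have "\<dots> \<le> \<rho> x + \<rho> y"
      unfolding \<rho>_def using a is_normD(1)[OF N] by (intro powr_add_le_add_powr) auto
    finally show ?thesis .
  qed
  have \<rho>_cont: "continuous_on UNIV \<rho>"
    unfolding \<rho>_def using a is_normD(1)[OF N]
    by (intro continuous_on_powr' is_norm_continuous[OF N] continuous_on_const) auto
  then have "isCont \<rho> 0" by (simp add: continuous_on_eq_continuous_at)
  moreover have "\<rho> 0 = 0" using is_normD(2)[OF N, of 0] by (simp add: \<rho>_def)
  ultimately have \<rho>_lim: "(\<rho> \<longlongrightarrow> 0) (at 0)" by (simp add: isCont_def)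
  obtain B where B: "B > 0" "\<And>x. N x \<le> B * norm x" using is_norm_le_norm[OF N] by blast
  have \<rho>_cell: "\<rho> (x - y) \<le> (B * CARD('n)) powr a" if "vfloor x = vfloor y" for x y
  proof -
    have "N (x - y) \<le> B * CARD('n)"
      using vfloor_eq_imp_norm_le[OF that] B(1) B(2)[of "x - y"]
      by (metis mult_left_mono less_imp_le order_trans)
    then show ?thesis unfolding \<rho>_def using a is_normD(1)[OF N] by (intro powr_mono2) auto
  qed
  define w where "w = smoothed \<rho> f"
  note \<rho> = \<open>\<rho> \<in> borel_measurable borel\<close> f0 f1 \<rho>0 \<rho>_minus \<rho>_add
  have w_cont: "continuous_on UNIV w" unfolding w_def by (rule continuous_on_smoothed[OF f_meas \<rho> \<rho>_lim])
  have w: "w x > 0" "w x \<le> 1" "exp (- \<rho> z) * w x \<le> w (x + z)" for x z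
    unfolding w_def by (rule smoothed_pos[OF f_meas \<rho>] smoothed_le_1[OF f_meas \<rho>] smoothed_shift[OF f_meas \<rho>])+
  have [measurable]: "w \<in> borel_measurable borel" using w_cont by (rule borel_measurable_continuous_onI)
  have int_w: "integrable P (\<lambda>x. ln (w x))"
    unfolding w_def P_def by (rule integrable_ln_smoothed[OF f_meas \<rho> \<rho>_cell H])
  have exp_\<rho>: "(\<integral>\<^sup>+z. ennreal (exp (- \<rho> z)) \<partial>lborel) = ennreal (norm_mass N a)"
    unfolding \<rho>_def by (rule nn_integral_exp_norm[OF N a(1)])
  then have w_int: "(\<integral>\<^sup>+x. ennreal (w x) \<partial>lborel) \<le> ennreal (norm_mass N a)"
    unfolding w_def nn_integral_smoothed[OF f_meas \<rho>] by simp
  \<comment> \<open>\<open>exp (- \<rho> z)\<close> serves a second time, now as the integrable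
    envelope under which \<open>f\<close> is clipped.\<close>
  have e: "continuous_on UNIV (\<lambda>z. exp (- \<rho> z))" "integrable lborel (\<lambda>z. exp (- \<rho> z))"
    "\<And>z. exp (- \<rho> z) > 0" "\<And>z. exp (- \<rho> z) \<le> 1"
    using exp_\<rho> \<rho>0 by (auto intro!: continuous_intros \<rho>_cont integrableI_nonneg)
  obtain q \<delta> M c where q_cont: "continuous_on UNIV q" and \<delta>: "\<delta> > 0"
    and q_ge: "\<And>x. \<delta> * w x \<le> q x" and q_le: "\<And>x. q x \<le> M"
    and q_int: "(\<integral>\<^sup>+x. ennreal (q x) \<partial>lborel) \<le> ennreal c" and c: "c \<ge> 0"
    and q_\<epsilon>: "(\<integral>x. ln (f x) \<partial>P) - (\<integral>x. ln (q x) \<partial>P) + c - 1 < \<epsilon>"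
    using exists_reference_density[OF f_meas f0 f1 int_f[unfolded P_def] int_w[unfolded P_def] w_cont w(1,2) w_int
        e(1,3,4,2) norm_mass_pos[OF N a(1)] \<epsilon>, folded P_def] by blast
  have [measurable]: "q \<in> borel_measurable borel" using q_cont by (rule borel_measurable_continuous_onI)
  have q0: "q x > 0" for x using q_ge[of x] \<delta> w(1)[of x] by (auto intro: less_le_trans[OF mult_pos_pos])
  \<comment> \<open>A majorant valid for all \<open>t\<close> between 0 and 1. Above,
    \<open>q x \<le> M\<close>; below, the shift inequality for \<open>w\<close> costs
    \<open>\<rho> (t *\<^sub>R z)\<close>, which is at most \<open>1 + N z powr r\<close> because
    \<open>a \<le> r\<close>, and this is integrable under the noise.\<close>
  let ?dom = "\<lambda>z. \<bar>ln M\<bar> + \<bar>ln \<delta>\<bar> + \<bar>ln (w (fst z))\<bar> + 1 + N (snd z) powr r"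
  have bound: "\<bar>ln (q (x + t *\<^sub>R z))\<bar> \<le> ?dom (x, z)" if t: "0 \<le> t" "t \<le> 1" for t x z
  proof -
    have Nz: "N z \<ge> 0" by (rule is_normD(1)[OF N])
    have "\<rho> (t *\<^sub>R z) \<le> N z powr a"
      unfolding \<rho>_def using a t Nz by (intro powr_mono2) (auto simp: is_normD(3)[OF N] mult_left_le_one_le)
    also have "\<dots> \<le> 1 + N z powr r"
    proof (cases "N z \<le> 1")
      case True
      then have "N z powr a \<le> 1" using a Nz by (simp add: powr_le1)
      then show ?thesis by (simp add: add_increasing2)
    next
      case False
      then have "N z powr a \<le> N z powr r" using a by (intro powr_mono) auto
      then show ?thesis by simp
    qed
    finally have \<rho>z: "\<rho> (t *\<^sub>R z) \<le> 1 + N z powr r" .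
    have "ln \<delta> + (- \<rho> (t *\<^sub>R z) + ln (w x)) = ln (\<delta> * (exp (- \<rho> (t *\<^sub>R z)) * w x))"
      using \<delta> w(1)[of x] by (simp add: ln_mult)
    also have "\<dots> \<le> ln (\<delta> * w (x + t *\<^sub>R z))"
      using \<delta> w(1) w(3)[of "t *\<^sub>R z" x] by (intro ln_mono) auto
    also have "\<dots> \<le> ln (q (x + t *\<^sub>R z))" using q_ge q0 \<delta> w(1) by (intro ln_mono) auto
    finally have "ln \<delta> - \<rho> (t *\<^sub>R z) + ln (w x) \<le> ln (q (x + t *\<^sub>R z))" by simp
    moreover have "ln (q (x + t *\<^sub>R z)) \<le> ln M" using q0 q_le by (intro ln_mono) (auto intro: less_le_trans)
    moreover have "N z powr r \<ge> 0" by simp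
    ultimately show ?thesis using \<rho>z unfolding fst_conv snd_conv by (intro abs_leI) linarith+
  qed
  have dom: "integrable (P \<Otimes>\<^sub>M noise N r) ?dom"
  proof -
    have "integrable (P \<Otimes>\<^sub>M noise N r) (\<lambda>z. ln (w (fst z)))"
      using int_w by (subst (asm) Z.distr_pair_fst[of P, symmetric], subst (asm) integrable_distr_eq) auto
    moreover have "integrable (noise N r) (\<lambda>z. N z powr r)"
      using nn_integral_noise_norm[OF N r] by (intro integrableI_nonneg) auto
    then have "integrable (P \<Otimes>\<^sub>M noise N r) (\<lambda>z. N (snd z) powr r)"
      by (subst (asm) distr_pair_snd[OF P.prob_space_axioms Z.sigma_finite_measure_axioms, symmetric],
          subst (asm) integrable_distr_eq) auto
    ultimately show ?thesis by auto
  qed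
  define t where "t D = (r * D / CARD('n)) powr (1 / r)" for D
  show ?thesis
  \<comment> \<open>Sequences suit dominated convergence; the cap \<open>CARD('n) / r\<close> on
    \<open>D n\<close> ensures \<open>t (D n) \<le> 1\<close>, the range covered by
    \<open>bound\<close>.\<close>
  proof (rule sequentially_imp_eventually_at_right[of 0 "CARD('n) / r"])
    show "0 < CARD('n) / r" using r by simp
    fix D :: "nat \<Rightarrow> real"
    assume D: "\<And>n. 0 < D n" "\<And>n. D n < CARD('n) / r" "D \<longlonglongrightarrow> 0"
    have t01: "0 \<le> t (D n)" "t (D n) \<le> 1" for n
    proof -
      have "r * D n / CARD('n) \<le> 1" using D(2)[of n] r by (simp add: field_simps)
      then show "t (D n) \<le> 1" unfolding t_def using r D(1)[of n] by (intro powr_le1) auto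
    qed (simp add: t_def)
    have t_lim: "(\<lambda>n. t (D n)) \<longlonglongrightarrow> 0"
    proof -
      have "(\<lambda>n. (r * D n / CARD('n)) powr (1 / r)) \<longlonglongrightarrow> (r * 0 / CARD('n)) powr (1 / r)"
        using r D(1) by (intro tendsto_powr' tendsto_intros D(3)) (auto intro!: always_eventually simp: less_imp_le)
      then show ?thesis by (simp add: t_def)
    qed
    let ?I = "\<lambda>n. \<integral>(x, z). ln (q (x + t (D n) *\<^sub>R z)) \<partial>(P \<Otimes>\<^sub>M noise N r)"
    have I_lim: "?I \<longlonglongrightarrow> (\<integral>z. ln (q (fst z)) \<partial>(P \<Otimes>\<^sub>M noise N r))"
    proof (rule integral_dominated_convergence[OF _ _ dom])
      show "AE z in P \<Otimes>\<^sub>M noise N r. (\<lambda>n. case z of (x, z) \<Rightarrow> ln (q (x + t (D n) *\<^sub>R z))) \<longlonglongrightarrow> ln (q (fst z))"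
      proof (intro AE_I2)
        fix z :: "(real^'n) \<times> (real^'n)"
        have "(\<lambda>n. fst z + t (D n) *\<^sub>R snd z) \<longlonglongrightarrow> fst z + 0 *\<^sub>R snd z"
          by (intro tendsto_intros t_lim)
        then have "(\<lambda>n. q (fst z + t (D n) *\<^sub>R snd z)) \<longlonglongrightarrow> q (fst z)"
          using continuous_on_tendsto_compose[OF q_cont] by simp
        then show "(\<lambda>n. case z of (x, z) \<Rightarrow> ln (q (x + t (D n) *\<^sub>R z))) \<longlonglongrightarrow> ln (q (fst z))"
          using q0[of "fst z"] by (auto simp: case_prod_unfold intro!: tendsto_ln)
      qed
      show "AE z in P \<Otimes>\<^sub>M noise N r. norm (case z of (x, z) \<Rightarrow> ln (q (x + t (D n) *\<^sub>R z))) \<le> ?dom z" for n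
        using bound[OF t01] by (intro AE_I2) (auto simp: case_prod_unfold)
    qed measurable
    also have "(\<integral>z. ln (q (fst z)) \<partial>(P \<Otimes>\<^sub>M noise N r)) = (\<integral>x. ln (q x) \<partial>P)"
      by (subst (2) Z.distr_pair_fst[of P, symmetric], subst integral_distr) auto
    finally have "(\<lambda>n. (\<integral>x. ln (f x) \<partial>P) - ?I n + c - 1) \<longlonglongrightarrow> (\<integral>x. ln (f x) \<partial>P) - (\<integral>x. ln (q x) \<partial>P) + c - 1"
      by (intro tendsto_intros)
    then have "\<forall>\<^sub>F n in sequentially. (\<integral>x. ln (f x) \<partial>P) - ?I n + c - 1 < \<epsilon>"
      using q_\<epsilon> by (rule order_tendstoD(2))
    then show "\<forall>\<^sub>F n in sequentially. rate_distortion f N r (D n) \<le> ereal (R_SLB f N r (D n) + \<epsilon>)"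
    proof eventually_elim
      case (elim n)
      have "integrable (P \<Otimes>\<^sub>M noise N r) (\<lambda>(x, z). ln (q (x + t (D n) *\<^sub>R z)))"
        using bound[OF t01[of n]] by (intro Bochner_Integration.integrable_bound[OF dom])
          (auto intro!: AE_I2 order_trans[OF _ abs_ge_self])
      then have "rate_distortion f N r (D n) \<le> ereal (R_SLB f N r (D n) - diff_entropy f - ?I n + c - 1)"
        unfolding P_def t_def
        by (intro rate_distortion_le[OF N r f_meas _ f0 f1 q0 q_int c D(1)]) auto
      \<comment> \<open>By \<open>h\<close>, \<open>- diff_entropy f\<close> is the mean of
        \<open>ln (f x)\<close>, so the excess is exactly the quantity bounded in
        \<open>elim\<close>.\<close>
      also have "\<dots> \<le> ereal (R_SLB f N r (D n) + \<epsilon>)" using elim by (simp add: h)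
      finally show ?case .
    qed
  qed
qed

section \<open>Both bounds combined into the limit\<close>

theorem theorem2:
  fixes f :: "real^'n \<Rightarrow> real" and N :: "real^'n \<Rightarrow> real" and r :: real
  assumes "is_norm N"
    and "r > 0"
    and "f \<in> borel_measurable lborel"
    and "\<And>x. f x \<ge> 0"
    and "(\<integral>\<^sup>+ x. ennreal (f x) \<partial>lborel) = 1"
    and "integrable lborel (\<lambda>x. f x * ln (f x))"
  shows "(floor_entropy f < \<infinity> \<longrightarrow>
            ((\<lambda>D. rate_distortion f N r D - ereal (R_SLB f N r D)) \<longlongrightarrow> 0) (at_right 0))
       \<and> (floor_entropy f = \<infinity> \<longrightarrow> (\<forall>D>0. rate_distortion f N r D = \<infinity>))"
proof (intro conjI impI allI)
  have f_meas: "f \<in> borel_measurable borel" using assms(3) by simp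
  show "rate_distortion f N r D = \<infinity>" if "floor_entropy f = \<infinity>" "D > 0" for D
    by (rule rate_distortion_infinite[OF assms(1,2) f_meas assms(4,5) that])
  assume H: "floor_entropy f < \<infinity>"
  show "((\<lambda>D. rate_distortion f N r D - ereal (R_SLB f N r D)) \<longlongrightarrow> 0) (at_right 0)"
  proof (rule order_tendstoI)
    fix l :: ereal assume l: "l < 0"
    have "l < rate_distortion f N r D - ereal (R_SLB f N r D)" if "D > 0" for D
    proof -
      have "ereal (R_SLB f N r D) \<le> rate_distortion f N r D"
        by (rule R_SLB_le_rate_distortion[OF assms(1,2) f_meas assms(4-6) that])
      then have "0 \<le> rate_distortion f N r D - ereal (R_SLB f N r D)"
        by (cases "rate_distortion f N r D") auto
      with l show ?thesis by (rule less_le_trans)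
    qed
    then show "\<forall>\<^sub>F D in at_right 0. l < rate_distortion f N r D - ereal (R_SLB f N r D)"
      using eventually_at_right_less[of 0] by (auto elim: eventually_mono)
  next
    fix l :: ereal assume "0 < l"
    then obtain \<epsilon> where \<epsilon>: "\<epsilon> > 0" "ereal \<epsilon> < l"
      using ereal_dense2[of 0 l] by (auto simp: zero_ereal_def)
    have "\<forall>\<^sub>F D in at_right 0. rate_distortion f N r D \<le> ereal (R_SLB f N r D + \<epsilon>)"
      by (rule eventually_rate_distortion_le[OF assms(1,2) f_meas assms(4-6) H \<epsilon>(1)])
    then show "\<forall>\<^sub>F D in at_right 0. rate_distortion f N r D - ereal (R_SLB f N r D) < l"
    proof eventually_elim
      case (elim D)
      then have "rate_distortion f N r D - ereal (R_SLB f N r D) \<le> ereal \<epsilon>"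
        by (cases "rate_distortion f N r D") auto
      then show ?case using \<epsilon>(2) by (rule le_less_trans)
    qed
  qed
qed

end
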